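(* The universal $C^*$-algebra generated by a power partial isometry is $^*$-isomorphic to the $C^*$-algebra $\mathcal{S}_{\ge 2}(\mathsf{T}(C))$ generated by the power partial isometry $(P_n V P_n)_{n\ge 1}$.
   Context: An element $v$ of a $C^*$-algebra is a partial isometry if $vv^*v=v$; it is a power partial isometry (PPI) if every power $v^n$, $n\ge 1$, is a partial isometry. $C^*$-algebras are not assumed to be unital. "The $C^*$-algebra generated by $v$" means the smallest $C^*$-(sub)algebra containing $v$. A $C^*$-algebra $\mathcal{A}$ generated by a PPI $v$ is called universal (the universal $C^*$-algebra generated by a PPI) if, for every other $C^*$-algebra $\mathcal{B}$ generated by a PPI $w$, there is a $^*$-homomorphism from $\mathcal{A}$ to $\mathcal{B}$ which sends $v$ to $w$. Let $V:(x_0,x_1,\ldots)\mapsto(0,x_0,x_1,\ldots)$ be the forward shift on $l^2(\mathbb{Z}^+)$, where $\mathbb{Z}^+$ is the set of non-negative integers, and let $P_n:(x_0,x_1,\ldots)\mapsto(x_0,\ldots,x_{n-1},0,0,\ldots)$ on $l^2(\mathbb{Z}^+)$, $n\ge 1$. Let $\mathcal{F}$ be the $C^*$-algebra of all bounded sequences $(A_n)_{n\ge 1}$ of operators $A_n\in L(\operatorname{im}P_n)\cong\mathbb{C}^{n\times n}$, with entrywise operations and the supremum norm. $\mathcal{S}_{\ge 2}(\mathsf{T}(C))$ is the $C^*$-subalgebra of $\mathcal{F}$ generated by the sequence $(P_nVP_n)_{n\ge 1}$, which is a PPI in $\mathcal{F}$. (Its first entry $P_1VP_1$ is zero, so the first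 entry of every element of $\mathcal{S}_{\ge 2}(\mathsf{T}(C))$ is zero.) *)

theory Defs
  imports "Jordan_Normal_Form.Schur_Decomposition"
begin

text \<open>
  Algebras are carrier-based, so that one can quantify over all C*-algebras living on
  subsets of a type inside a formula. The record inherits a field \<^term>\<open>one\<close>, but no
  definition below relies on it: C*-algebras need not be unital. In particular
  the power operation of HOL-Algebra, which starts from \<^term>\<open>one\<close>, is avoided.
\<close>

record 'a cstar = "(complex, 'a) module" +
  adj :: "'a \<Rightarrow> 'a"
  cnorm :: "'a \<Rightarrow> real"

locale cstar_algebra =
  vectorspace "class_ring :: complex ring" A for A :: "('a, 'm) cstar_scheme" (structure) +
  assumes mult_closed: "\<lbrakk>x \<in> carrier A; y \<in> carrier A\<rbrakk> \<Longrightarrow> x \<otimes> y \<in> carrier A"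
    and mult_assoc: "\<lbrakk>x \<in> carrier A; y \<in> carrier A; z \<in> carrier A\<rbrakk>
          \<Longrightarrow> (x \<otimes> y) \<otimes> z = x \<otimes> (y \<otimes> z)"
    and distrib_right: "\<lbrakk>x \<in> carrier A; y \<in> carrier A; z \<in> carrier A\<rbrakk>
          \<Longrightarrow> (x \<oplus> y) \<otimes> z = x \<otimes> z \<oplus> y \<otimes> z"
    and distrib_left: "\<lbrakk>x \<in> carrier A; y \<in> carrier A; z \<in> carrier A\<rbrakk>
          \<Longrightarrow> x \<otimes> (y \<oplus> z) = x \<otimes> y \<oplus> x \<otimes> z"
    and smult_mult_left: "\<lbrakk>x \<in> carrier A; y \<in> carrier A\<rbrakk>
          \<Longrightarrow> (c \<odot>\<^bsub>A\<^esub> x) \<otimes> y = c \<odot>\<^bsub>A\<^esub> (x \<otimes> y)"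
    and smult_mult_right: "\<lbrakk>x \<in> carrier A; y \<in> carrier A\<rbrakk>
          \<Longrightarrow> x \<otimes> (c \<odot>\<^bsub>A\<^esub> y) = c \<odot>\<^bsub>A\<^esub> (x \<otimes> y)"
    and adj_closed: "x \<in> carrier A \<Longrightarrow> adj A x \<in> carrier A"
    and adj_adj: "x \<in> carrier A \<Longrightarrow> adj A (adj A x) = x"
    and adj_add: "\<lbrakk>x \<in> carrier A; y \<in> carrier A\<rbrakk> \<Longrightarrow> adj A (x \<oplus> y) = adj A x \<oplus> adj A y"
    and adj_smult: "x \<in> carrier A \<Longrightarrow> adj A (c \<odot>\<^bsub>A\<^esub> x) = cnj c \<odot>\<^bsub>A\<^esub> adj A x"
    and adj_mult: "\<lbrakk>x \<in> carrier A; y \<in> carrier A\<rbrakk> \<Longrightarrow> adj A (x \<otimes> y) = adj A y \<otimes> adj A x"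
    and cnorm_nonneg: "x \<in> carrier A \<Longrightarrow> 0 \<le> cnorm A x"
    and cnorm_eq_0: "x \<in> carrier A \<Longrightarrow> cnorm A x = 0 \<longleftrightarrow> x = \<zero>"
    and cnorm_triangle: "\<lbrakk>x \<in> carrier A; y \<in> carrier A\<rbrakk>
          \<Longrightarrow> cnorm A (x \<oplus> y) \<le> cnorm A x + cnorm A y"
    and cnorm_smult: "x \<in> carrier A \<Longrightarrow> cnorm A (c \<odot>\<^bsub>A\<^esub> x) = cmod c * cnorm A x"
    and cnorm_mult: "\<lbrakk>x \<in> carrier A; y \<in> carrier A\<rbrakk>
          \<Longrightarrow> cnorm A (x \<otimes> y) \<le> cnorm A x * cnorm A y"
    and cstar_identity: "x \<in> carrier A \<Longrightarrow> cnorm A (adj A x \<otimes> x) = (cnorm A x)\<^sup>2"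
    and complete:
      "\<lbrakk>\<And>n. s n \<in> carrier A;
        \<And>e. e > 0 \<Longrightarrow> \<exists>N. \<forall>m\<ge>N. \<forall>n\<ge>N. cnorm A (s m \<ominus> s n) < e\<rbrakk>
       \<Longrightarrow> \<exists>x\<in>carrier A. (\<lambda>n::nat. cnorm A (s n \<ominus> x)) \<longlonglongrightarrow> 0"

definition cstar_subalgebra :: "'a set \<Rightarrow> 'a cstar \<Rightarrow> bool" where
  "cstar_subalgebra C A \<longleftrightarrow> C \<subseteq> carrier A \<and> cstar_algebra (A\<lparr>carrier := C\<rparr>)"

definition cstar_generated :: "'a cstar \<Rightarrow> 'a \<Rightarrow> 'a set" where
  "cstar_generated A v = \<Inter>{C. cstar_subalgebra C A \<and> v \<in> C}"

text \<open>\<open>pow_Suc A v n\<close> is the power with exponent \<open>n + 1\<close>.\<close>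

primrec pow_Suc :: "'a cstar \<Rightarrow> 'a \<Rightarrow> nat \<Rightarrow> 'a" where
  "pow_Suc A v 0 = v"
| "pow_Suc A v (Suc n) = pow_Suc A v n \<otimes>\<^bsub>A\<^esub> v"

definition partial_isometry :: "'a cstar \<Rightarrow> 'a \<Rightarrow> bool" where
  "partial_isometry A v \<longleftrightarrow> v \<in> carrier A \<and> v \<otimes>\<^bsub>A\<^esub> adj A v \<otimes>\<^bsub>A\<^esub> v = v"

definition power_partial_isometry :: "'a cstar \<Rightarrow> 'a \<Rightarrow> bool" where
  "power_partial_isometry A v \<longleftrightarrow> (\<forall>n. partial_isometry A (pow_Suc A v n))"

definition generated_by_ppi :: "'a cstar \<Rightarrow> 'a \<Rightarrow> bool" where
  "generated_by_ppi A v \<longleftrightarrow>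
     cstar_algebra A \<and> power_partial_isometry A v \<and> cstar_generated A v = carrier A"

definition star_hom :: "'a cstar \<Rightarrow> 'b cstar \<Rightarrow> ('a \<Rightarrow> 'b) set" where
  "star_hom A B = {h \<in> carrier A \<rightarrow> carrier B.
     (\<forall>x\<in>carrier A. \<forall>y\<in>carrier A. h (x \<oplus>\<^bsub>A\<^esub> y) = h x \<oplus>\<^bsub>B\<^esub> h y) \<and>
     (\<forall>c. \<forall>x\<in>carrier A. h (c \<odot>\<^bsub>A\<^esub> x) = c \<odot>\<^bsub>B\<^esub> h x) \<and>
     (\<forall>x\<in>carrier A. \<forall>y\<in>carrier A. h (x \<otimes>\<^bsub>A\<^esub> y) = h x \<otimes>\<^bsub>B\<^esub> h y) \<and>
     (\<forall>x\<in>carrier A. h (adj A x) = adj B (h x))}"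

definition star_isomorphic :: "'a cstar \<Rightarrow> 'b cstar \<Rightarrow> bool" where
  "star_isomorphic A B \<longleftrightarrow> (\<exists>h\<in>star_hom A B. bij_betw h (carrier A) (carrier B))"

text \<open>
  The universal property against all C*-algebras generated by a power partial isometry
  whose carrier is a subset of the type \<open>'b\<close>. A C*-algebra generated by one element is
  separable, hence of cardinality at most the continuum; so for a type \<open>'b\<close> of at least
  that cardinality (such as \<^typ>\<open>nat \<Rightarrow> complex mat\<close>) this covers, up to isomorphism,
  all C*-algebras generated by a power partial isometry.
\<close>

definition universal_ppi_algebra :: "'b itself \<Rightarrow> 'a cstar \<Rightarrow> 'a \<Rightarrow> bool" where
  "universal_ppi_algebra T A v \<longleftrightarrow> generated_by_ppi A v \<and>
     (\<forall>(B::'b cstar) w. generated_by_ppi B w \<longrightarrow> (\<exists>h\<in>star_hom A B. h v = w))"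

definition mat_opnorm :: "complex mat \<Rightarrow> real" where
  "mat_opnorm M = (SUP x\<in>{x \<in> carrier_vec (dim_col M). Re (x \<bullet>c x) \<le> 1}.
     sqrt (Re ((M *\<^sub>v x) \<bullet>c (M *\<^sub>v x))))"

text \<open>
  The algebra of bounded sequences of \<open>n \<times> n\<close> matrices, \<open>n \<ge> 1\<close>. The sequences carry an
  additional entry at index 0, which is the unique \<open>0 \<times> 0\<close> matrix.
\<close>

definition mat_seq_algebra :: "(nat \<Rightarrow> complex mat) cstar" where
  "mat_seq_algebra =
    \<lparr> carrier = {M. (\<forall>n. M n \<in> carrier_mat n n) \<and> bdd_above ((\<lambda>n. mat_opnorm (M n)) ` {1..})},
      monoid.mult = (\<lambda>M N n. M n * N n),
      one = (\<lambda>n. 1\<^sub>m n),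
      zero = (\<lambda>n. 0\<^sub>m n n),
      add = (\<lambda>M N n. M n + N n),
      module.smult = (\<lambda>c M n. c \<cdot>\<^sub>m M n),
      adj = (\<lambda>M n. mat_adjoint (M n)),
      cnorm = (\<lambda>M. SUP n\<in>{1..}. mat_opnorm (M n)) \<rparr>"

definition fwd_shift :: "(nat \<Rightarrow> complex) \<Rightarrow> nat \<Rightarrow> complex" where
  "fwd_shift x = (\<lambda>i. case i of 0 \<Rightarrow> 0 | Suc j \<Rightarrow> x j)"

definition trunc :: "nat \<Rightarrow> (nat \<Rightarrow> complex) \<Rightarrow> nat \<Rightarrow> complex" where
  "trunc n x = (\<lambda>i. if i < n then x i else 0)"

text \<open>The matrix, in the standard basis, of an operator on the image of \<^term>\<open>trunc n\<close>.\<close>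

definition section_mat :: "nat \<Rightarrow> ((nat \<Rightarrow> complex) \<Rightarrow> nat \<Rightarrow> complex) \<Rightarrow> complex mat" where
  "section_mat n T = mat n n (\<lambda>(i, j). T (\<lambda>k. if k = j then 1 else 0) i)"

definition shift_sections :: "nat \<Rightarrow> complex mat" where
  "shift_sections n = section_mat n (trunc n \<circ> fwd_shift \<circ> trunc n)"

definition shift_sections_algebra :: "(nat \<Rightarrow> complex mat) cstar" where
  "shift_sections_algebra =
     mat_seq_algebra\<lparr>carrier := cstar_generated mat_seq_algebra shift_sections\<rparr>"

end

theory Submission
  imports Defs "HOL-Analysis.L2_Norm"
begin

text \<open>
  Write \<open>V\<close> for the sequence of truncated shifts, and call noncommutative polynomials in an
  element and its adjoint, without constant term, *-polynomials. The heart of the matter is the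
  inequality \<open>\<parallel>p(w)\<parallel> \<le> \<parallel>p(V)\<parallel>\<close> for every power partial isometry \<open>w\<close> in a C*-algebra and every
  *-polynomial \<open>p\<close> (\<open>cnorm_le_shift\<close>). It follows from three facts.

  \<^item> Since \<open>w\<^sup>n\<^sup>+\<^sup>1\<close> is a partial isometry, the projections \<open>w\<^sup>* w\<close> and \<open>w\<^sup>n (w\<^sup>*)\<^sup>n\<close> commute. This
  suffices to bring every word in \<open>w\<close> and \<open>w\<^sup>*\<close> to the form \<open>w\<^sup>a (w\<^sup>*)\<^sup>a\<^sup>+\<^sup>b w\<^sup>d\<close> with \<open>d \<le> a + b\<close>
  (\<open>word_val_std\<close>). So the value of a *-polynomial of degree \<open>n\<close> is a linear combination of at
  most \<open>(n + 1)\<^sup>3\<close> elements of norm at most one, with coefficients that do not depend on the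
  algebra.

  \<^item> An entry of a block of \<open>p(V)\<close> is the sum of those coefficients over a rectangle in \<open>(a, b)\<close>.
  Every coefficient is therefore an alternating sum of four entries and bounded by \<open>4 \<parallel>p(V)\<parallel>\<close>
  (\<open>coefficient_bound\<close>). Hence \<open>\<parallel>p(w)\<parallel> \<le> 4 (n + 1)\<^sup>3 \<parallel>p(V)\<parallel>\<close>.

  \<^item> For self-adjoint \<open>x\<close>, the C*-identity gives \<open>\<parallel>x\<^sup>m\<parallel> = \<parallel>x\<parallel>\<^sup>m\<close> when \<open>m\<close> is a power of two. Applying
  the previous bound to powers of \<open>p\<^sup>* p\<close> and extracting roots removes the polynomial factor
  (\<open>same_poly_contractive\<close>).

  By completeness, \<open>p(V) \<mapsto> p(w)\<close> extends to a *-homomorphism defined on the C*-algebra generated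
  by \<open>V\<close> (\<open>star_hom_exists\<close>), which is the universal property.

  Now let \<open>v\<close> generate another universal algebra. There is a *-homomorphism sending \<open>v\<close> to \<open>V\<close>, and
  the reverse inequality \<open>\<parallel>p(V)\<parallel> \<le> \<parallel>p(v)\<parallel>\<close> is wanted (\<open>contractive_universal\<close>). By the argument
  above, it is enough to bound the entries of \<open>p(V)\<close> by a multiple of \<open>\<parallel>p(v)\<parallel>\<close>. For each \<open>m \<ge> 1\<close>
  there is a *-polynomial, the corner, whose value at \<open>V\<close> is a matrix unit in the block of size
  \<open>m + 1\<close> and zero in all other blocks. Multiplying \<open>p(V)\<close> by corners and words from both sides
  yields an entry of \<open>p(V)\<close> times the corner. This identity passes to \<open>v\<close> by the inequality already
  proved, and the corner of \<open>v\<close> is nonzero because its image is. So the entry is bounded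
  (\<open>cmod_entry_le\<close>). With both inequalities, \<open>p(V) \<mapsto> p(v)\<close> is isometric and extends to a
  *-isomorphism (\<open>isometric_star_isomorphic\<close>).
\<close>

section \<open>C*-algebras and C*-subalgebras\<close>

text \<open>
  Scalar multiplication by \<open>-1\<close> supplies the additive inverses.
\<close>

lemma module_class_ringI:
  fixes A :: "(complex, 'a, 'm) module_scheme" (structure)
  assumes "\<zero> \<in> carrier A"
    and "\<And>x y. \<lbrakk>x \<in> carrier A; y \<in> carrier A\<rbrakk> \<Longrightarrow> x \<oplus> y \<in> carrier A"
    and "\<And>c x. x \<in> carrier A \<Longrightarrow> c \<odot>\<^bsub>A\<^esub> x \<in> carrier A"
    and "\<And>x y z. \<lbrakk>x \<in> carrier A; y \<in> carrier A; z \<in> carrier A\<rbrakk> \<Longrightarrow> (x \<oplus> y) \<oplus> z = x \<oplus> (y \<oplus> z)"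
    and "\<And>x y. \<lbrakk>x \<in> carrier A; y \<in> carrier A\<rbrakk> \<Longrightarrow> x \<oplus> y = y \<oplus> x"
    and "\<And>x. x \<in> carrier A \<Longrightarrow> \<zero> \<oplus> x = x"
    and "\<And>x. x \<in> carrier A \<Longrightarrow> 0 \<odot>\<^bsub>A\<^esub> x = \<zero>"
    and "\<And>x. x \<in> carrier A \<Longrightarrow> 1 \<odot>\<^bsub>A\<^esub> x = x"
    and "\<And>c d x. x \<in> carrier A \<Longrightarrow> (c + d) \<odot>\<^bsub>A\<^esub> x = c \<odot>\<^bsub>A\<^esub> x \<oplus> d \<odot>\<^bsub>A\<^esub> x"
    and "\<And>c x y. \<lbrakk>x \<in> carrier A; y \<in> carrier A\<rbrakk> \<Longrightarrow> c \<odot>\<^bsub>A\<^esub> (x \<oplus> y) = c \<odot>\<^bsub>A\<^esub> x \<oplus> c \<odot>\<^bsub>A\<^esub> y"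
    and "\<And>c d x. x \<in> carrier A \<Longrightarrow> (c * d) \<odot>\<^bsub>A\<^esub> x = c \<odot>\<^bsub>A\<^esub> (d \<odot>\<^bsub>A\<^esub> x)"
  shows "vectorspace (class_ring :: complex ring) A"
proof -
  have "\<exists>y\<in>carrier A. y \<oplus> x = \<zero>" if "x \<in> carrier A" for x
    using assms(3)[OF that, of "-1"] assms(7-9)[OF that] assms(9)[OF that, of "-1" 1] by force
  then have "abelian_group A"
    using assms by (intro abelian_groupI) auto
  moreover have "field (class_ring :: complex ring)"
    by (rule class_field.field_axioms)
  ultimately show ?thesis
    using assms
    by (auto intro!: vectorspace.intro moduleI simp: field_def domain_def)
qed

context cstar_algebra
begin

lemma smult_in [simp, intro]: "x \<in> carrier A \<Longrightarrow> c \<odot>\<^bsub>A\<^esub> x \<in> carrier A"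
  by (simp add: smult_closed)

lemma smult_zero_left [simp]: "x \<in> carrier A \<Longrightarrow> 0 \<odot>\<^bsub>A\<^esub> x = \<zero>"
  using smult_l_null by simp

lemma smult_zero_right [simp]: "c \<odot>\<^bsub>A\<^esub> \<zero> = \<zero>"
  using smult_r_null by simp

lemma smult_one_left [simp]: "x \<in> carrier A \<Longrightarrow> 1 \<odot>\<^bsub>A\<^esub> x = x"
  using smult_one by simp

lemma smult_add_left: "x \<in> carrier A \<Longrightarrow> (c + d) \<odot>\<^bsub>A\<^esub> x = c \<odot>\<^bsub>A\<^esub> x \<oplus> d \<odot>\<^bsub>A\<^esub> x"
  using smult_l_distr by simp

lemma smult_add_right:
  "\<lbrakk>x \<in> carrier A; y \<in> carrier A\<rbrakk> \<Longrightarrow> c \<odot>\<^bsub>A\<^esub> (x \<oplus> y) = c \<odot>\<^bsub>A\<^esub> x \<oplus> c \<odot>\<^bsub>A\<^esub> y"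
  using smult_r_distr by simp

lemma smult_smult: "x \<in> carrier A \<Longrightarrow> c \<odot>\<^bsub>A\<^esub> (d \<odot>\<^bsub>A\<^esub> x) = (c * d) \<odot>\<^bsub>A\<^esub> x"
  using smult_assoc1 by simp

text \<open>
  Additive inverses are defined relative to the carrier, scalar multiples are not. Writing
  differences in this form is what makes them agree in an algebra and in its subalgebras.
\<close>

lemma minus_eq_smult:
  "\<lbrakk>x \<in> carrier A; y \<in> carrier A\<rbrakk> \<Longrightarrow> x \<ominus> y = x \<oplus> (-1) \<odot>\<^bsub>A\<^esub> y"
  using smult_l_minus[of 1 y] by (simp add: a_minus_def class_ring_simps)

declare mult_closed [simp, intro] adj_closed [simp, intro] adj_adj [simp]

lemma mult_zero_left [simp]: "x \<in> carrier A \<Longrightarrow> \<zero> \<otimes> x = \<zero>"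
  using smult_mult_left[of x x 0] by simp

lemma mult_zero_right [simp]: "x \<in> carrier A \<Longrightarrow> x \<otimes> \<zero> = \<zero>"
  using smult_mult_right[of x x 0] by simp

lemma adj_zero [simp]: "adj A \<zero> = \<zero>"
  using adj_smult[of \<zero> 0] by simp

lemma cnorm_zero [simp]: "cnorm A \<zero> = 0"
  by (simp add: cnorm_eq_0)

lemma minus_in [simp, intro]: "\<lbrakk>x \<in> carrier A; y \<in> carrier A\<rbrakk> \<Longrightarrow> x \<ominus> y \<in> carrier A"
  by simp

lemma cnorm_adj [simp]:
  assumes "x \<in> carrier A" shows "cnorm A (adj A x) = cnorm A x"
proof -
  have le: "cnorm A y \<le> cnorm A (adj A y)" if "y \<in> carrier A" for y
  proof (cases "cnorm A y = 0")
    case False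
    have "(cnorm A y)\<^sup>2 \<le> cnorm A (adj A y) * cnorm A y"
      using cstar_identity[OF that] cnorm_mult[of "adj A y" y] that by simp
    then show ?thesis
      using False cnorm_nonneg[OF that] by (simp add: power2_eq_square)
  qed (use that cnorm_nonneg in simp)
  show ?thesis
    using le[OF assms] le[of "adj A x"] assms by simp
qed

lemma adj_mult_self_eq_zero:
  "\<lbrakk>x \<in> carrier A; adj A x \<otimes> x = \<zero>\<rbrakk> \<Longrightarrow> x = \<zero>"
  using cstar_identity[of x] cnorm_eq_0[of x] by simp

lemma minus_eq_zero_iff:
  "\<lbrakk>x \<in> carrier A; y \<in> carrier A\<rbrakk> \<Longrightarrow> x \<ominus> y = \<zero> \<longleftrightarrow> x = y"
  by (metis a_minus_def add.inv_closed minus_equality minus_minus r_neg)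

lemma dist_eq_zero_iff:
  "\<lbrakk>x \<in> carrier A; y \<in> carrier A\<rbrakk> \<Longrightarrow> cnorm A (x \<ominus> y) = 0 \<longleftrightarrow> x = y"
  by (simp add: cnorm_eq_0 minus_eq_zero_iff)

lemma dist_commute:
  assumes "x \<in> carrier A" "y \<in> carrier A"
  shows "cnorm A (x \<ominus> y) = cnorm A (y \<ominus> x)"
proof -
  have "x \<ominus> y = (-1) \<odot>\<^bsub>A\<^esub> (y \<ominus> x)"
    using assms by (simp add: minus_eq_smult smult_add_right smult_smult a_comm)
  then show ?thesis
    using assms by (simp add: cnorm_smult)
qed

lemma dist_triangle:
  assumes "x \<in> carrier A" "y \<in> carrier A" "z \<in> carrier A"
  shows "cnorm A (x \<ominus> z) \<le> cnorm A (x \<ominus> y) + cnorm A (y \<ominus> z)"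
proof -
  have "x \<ominus> z = (x \<ominus> y) \<oplus> (y \<ominus> z)"
    using assms by (simp add: a_minus_def a_assoc r_neg1)
  then show ?thesis
    using cnorm_triangle[of "x \<ominus> y" "y \<ominus> z"] assms by simp
qed

lemma cnorm_le_dist:
  assumes "x \<in> carrier A" "y \<in> carrier A"
  shows "cnorm A x \<le> cnorm A y + cnorm A (x \<ominus> y)"
  using dist_triangle[of x y \<zero>] assms by (simp add: minus_eq_smult)

lemma cnorm_minus_le:
  assumes "x \<in> carrier A" "y \<in> carrier A"
  shows "cnorm A (x \<ominus> y) \<le> cnorm A x + cnorm A y"
  using cnorm_triangle[of x "(-1) \<odot>\<^bsub>A\<^esub> y"] assms by (simp add: minus_eq_smult cnorm_smult)

lemma dist_add:
  assumes "x \<in> carrier A" "y \<in> carrier A" "x' \<in> carrier A" "y' \<in> carrier A"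
  shows "cnorm A ((x \<oplus> y) \<ominus> (x' \<oplus> y')) \<le> cnorm A (x \<ominus> x') + cnorm A (y \<ominus> y')"
proof -
  have "(x \<oplus> y) \<ominus> (x' \<oplus> y') = (x \<ominus> x') \<oplus> (y \<ominus> y')"
    using assms by (simp add: minus_eq_smult smult_add_right a_ac)
  then show ?thesis
    using cnorm_triangle[of "x \<ominus> x'" "y \<ominus> y'"] assms by simp
qed

lemma dist_smult:
  assumes "x \<in> carrier A" "y \<in> carrier A"
  shows "cnorm A (c \<odot>\<^bsub>A\<^esub> x \<ominus> c \<odot>\<^bsub>A\<^esub> y) = cmod c * cnorm A (x \<ominus> y)"
proof -
  have "c \<odot>\<^bsub>A\<^esub> x \<ominus> c \<odot>\<^bsub>A\<^esub> y = c \<odot>\<^bsub>A\<^esub> (x \<ominus> y)"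
    using assms by (simp add: minus_eq_smult smult_add_right smult_smult)
  then show ?thesis
    using assms by (simp add: cnorm_smult)
qed

lemma dist_adj:
  assumes "x \<in> carrier A" "y \<in> carrier A"
  shows "cnorm A (adj A x \<ominus> adj A y) = cnorm A (x \<ominus> y)"
proof -
  have "adj A x \<ominus> adj A y = adj A (x \<ominus> y)"
    using assms by (simp add: minus_eq_smult adj_add adj_smult)
  then show ?thesis
    using assms by simp
qed

lemma mult_minus_left:
  "\<lbrakk>x \<in> carrier A; y \<in> carrier A; z \<in> carrier A\<rbrakk> \<Longrightarrow> (x \<ominus> y) \<otimes> z = x \<otimes> z \<ominus> y \<otimes> z"
  by (simp add: minus_eq_smult distrib_right smult_mult_left)

lemma mult_minus_right:
  "\<lbrakk>x \<in> carrier A; y \<in> carrier A; z \<in> carrier A\<rbrakk> \<Longrightarrow> z \<otimes> (x \<ominus> y) = z \<otimes> x \<ominus> z \<otimes> y"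
  by (simp add: minus_eq_smult distrib_left smult_mult_right)

lemma dist_mult:
  assumes "x \<in> carrier A" "y \<in> carrier A" "x' \<in> carrier A" "y' \<in> carrier A"
  shows "cnorm A (x \<otimes> y \<ominus> x' \<otimes> y')
    \<le> cnorm A x * cnorm A (y \<ominus> y') + cnorm A (x \<ominus> x') * cnorm A y'"
proof -
  have "cnorm A (x \<otimes> y \<ominus> x' \<otimes> y')
      \<le> cnorm A (x \<otimes> y \<ominus> x \<otimes> y') + cnorm A (x \<otimes> y' \<ominus> x' \<otimes> y')"
    using assms by (intro dist_triangle) auto
  also have "\<dots> = cnorm A (x \<otimes> (y \<ominus> y')) + cnorm A ((x \<ominus> x') \<otimes> y')"
    using assms by (simp add: mult_minus_left mult_minus_right)
  finally show ?thesis
    using cnorm_mult[of x "y \<ominus> y'"] cnorm_mult[of "x \<ominus> x'" y'] assms by simp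
qed

definition tends :: "(nat \<Rightarrow> 'a) \<Rightarrow> 'a \<Rightarrow> bool" where
  "tends s x \<longleftrightarrow> (\<lambda>n. cnorm A (s n \<ominus> x)) \<longlonglongrightarrow> 0"

lemma tends_le:
  assumes "\<And>n. cnorm A (s n \<ominus> x) \<le> f n" "f \<longlonglongrightarrow> 0" "\<And>n. s n \<in> carrier A" "x \<in> carrier A"
  shows "tends s x"
  unfolding tends_def
  by (rule tendsto_sandwich[OF _ _ tendsto_const assms(2)])
    (use assms(1,3,4) in \<open>simp_all add: cnorm_nonneg\<close>)

lemma tends_const: "x \<in> carrier A \<Longrightarrow> tends (\<lambda>_. x) x"
  by (simp add: tends_def dist_eq_zero_iff[THEN iffD2])

lemma tends_unique:
  assumes "tends s x" "tends s y" "\<And>n. s n \<in> carrier A" "x \<in> carrier A" "y \<in> carrier A"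
  shows "x = y"
proof -
  have "cnorm A (x \<ominus> y) \<le> cnorm A (s n \<ominus> x) + cnorm A (s n \<ominus> y)" for n
    using dist_triangle[of x "s n" y] assms(3-5) dist_commute[of x "s n"] by simp
  moreover have "(\<lambda>n. cnorm A (s n \<ominus> x) + cnorm A (s n \<ominus> y)) \<longlonglongrightarrow> 0"
    using tendsto_add[OF assms(1,2)[unfolded tends_def]] by simp
  ultimately have "cnorm A (x \<ominus> y) \<le> 0"
    by (intro LIMSEQ_le_const) auto
  then show ?thesis
    using cnorm_nonneg[of "x \<ominus> y"] dist_eq_zero_iff assms(4,5) by force
qed

lemma tends_cnorm:
  assumes "tends s x" "\<And>n. s n \<in> carrier A" "x \<in> carrier A"
  shows "(\<lambda>n. cnorm A (s n)) \<longlonglongrightarrow> cnorm A x"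
proof -
  have "\<bar>cnorm A (s n) - cnorm A x\<bar> \<le> cnorm A (s n \<ominus> x)" for n
    using cnorm_le_dist[of "s n" x] cnorm_le_dist[of x "s n"] dist_commute[of "s n" x] assms(2,3)
    by auto
  then have "(\<lambda>n. \<bar>cnorm A (s n) - cnorm A x\<bar>) \<longlonglongrightarrow> 0"
    by (intro tendsto_sandwich[OF _ _ tendsto_const assms(1)[unfolded tends_def]]) simp_all
  then have "(\<lambda>n. cnorm A (s n) - cnorm A x) \<longlonglongrightarrow> 0"
    by (rule tendsto_rabs_zero_cancel)
  then show ?thesis
    by (rule LIM_zero_cancel)
qed

lemma tends_add:
  assumes "tends s x" "tends t y" "\<And>n. s n \<in> carrier A" "\<And>n. t n \<in> carrier A"
    "x \<in> carrier A" "y \<in> carrier A"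
  shows "tends (\<lambda>n. s n \<oplus> t n) (x \<oplus> y)"
proof (rule tends_le)
  show "(\<lambda>n. cnorm A (s n \<ominus> x) + cnorm A (t n \<ominus> y)) \<longlonglongrightarrow> 0"
    using tendsto_add[OF assms(1,2)[unfolded tends_def]] by simp
qed (use assms(3-6) dist_add in auto)

lemma tends_smult:
  assumes "tends s x" "\<And>n. s n \<in> carrier A" "x \<in> carrier A"
  shows "tends (\<lambda>n. c \<odot>\<^bsub>A\<^esub> s n) (c \<odot>\<^bsub>A\<^esub> x)"
proof (rule tends_le)
  show "(\<lambda>n. cmod c * cnorm A (s n \<ominus> x)) \<longlonglongrightarrow> 0"
    using tendsto_mult_left[OF assms(1)[unfolded tends_def], of "cmod c"] by simp
qed (use assms(2,3) dist_smult in auto)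

lemma tends_adj:
  assumes "tends s x" "\<And>n. s n \<in> carrier A" "x \<in> carrier A"
  shows "tends (\<lambda>n. adj A (s n)) (adj A x)"
  using assms by (simp add: tends_def dist_adj)

lemma tends_mult:
  assumes "tends s x" "tends t y" "\<And>n. s n \<in> carrier A" "\<And>n. t n \<in> carrier A"
    "x \<in> carrier A" "y \<in> carrier A"
  shows "tends (\<lambda>n. s n \<otimes> t n) (x \<otimes> y)"
proof (rule tends_le)
  show "(\<lambda>n. cnorm A (s n) * cnorm A (t n \<ominus> y) + cnorm A (s n \<ominus> x) * cnorm A y) \<longlonglongrightarrow> 0"
    using tendsto_add[OF tendsto_mult[OF tends_cnorm[OF assms(1,3,5)] assms(2)[unfolded tends_def]]
        tendsto_mult_right[OF assms(1)[unfolded tends_def], of "cnorm A y"]] by simp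
qed (use assms(3-6) dist_mult in auto)

lemma tends_Cauchy:
  assumes "tends s x" "\<And>n. s n \<in> carrier A" "x \<in> carrier A" "e > 0"
  shows "\<exists>N. \<forall>m\<ge>N. \<forall>n\<ge>N. cnorm A (s m \<ominus> s n) < e"
proof -
  have "e / 2 > 0" using assms(4) by simp
  then obtain N where "\<forall>n\<ge>N. norm (cnorm A (s n \<ominus> x) - 0) < e / 2"
    using assms(1) unfolding tends_def by (meson LIMSEQ_iff)
  then have N: "cnorm A (s n \<ominus> x) < e / 2" if "n \<ge> N" for n
    using that by fastforce
  have "cnorm A (s m \<ominus> s n) < e" if "m \<ge> N" "n \<ge> N" for m n
    using dist_triangle[of "s m" x "s n"] dist_commute[of x "s n"] N[OF that(1)] N[OF that(2)]
      assms(2,3) by simp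
  then show ?thesis by blast
qed

end

text \<open>
  Being a C*-subalgebra is a closure property, and so stable under intersection. Completeness
  of the subset turns into closure under limits: a convergent sequence is Cauchy, hence has a
  limit inside the subset, and limits are unique. Conversely, a Cauchy sequence in the subset
  converges in the ambient algebra.
\<close>

lemma cstar_subalgebraD:
  assumes "cstar_algebra A" "cstar_subalgebra C A"
  shows "C \<subseteq> carrier A" "\<zero>\<^bsub>A\<^esub> \<in> C"
    and "\<And>x y. \<lbrakk>x \<in> C; y \<in> C\<rbrakk> \<Longrightarrow> x \<oplus>\<^bsub>A\<^esub> y \<in> C"
    and "\<And>c x. x \<in> C \<Longrightarrow> c \<odot>\<^bsub>A\<^esub> x \<in> C"
    and "\<And>x y. \<lbrakk>x \<in> C; y \<in> C\<rbrakk> \<Longrightarrow> x \<otimes>\<^bsub>A\<^esub> y \<in> C"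
    and "\<And>x. x \<in> C \<Longrightarrow> adj A x \<in> C"
    and "\<And>s x. \<lbrakk>\<And>n. s n \<in> C; x \<in> carrier A; cstar_algebra.tends A s x\<rbrakk> \<Longrightarrow> x \<in> C"
proof -
  interpret A: cstar_algebra A by fact
  let ?C = "A\<lparr>carrier := C\<rparr>"
  show sub: "C \<subseteq> carrier A"
    using assms(2) by (simp add: cstar_subalgebra_def)
  interpret C: cstar_algebra ?C
    using assms(2) by (simp add: cstar_subalgebra_def)
  show "\<zero>\<^bsub>A\<^esub> \<in> C" "\<And>x y. \<lbrakk>x \<in> C; y \<in> C\<rbrakk> \<Longrightarrow> x \<oplus>\<^bsub>A\<^esub> y \<in> C"
    "\<And>c x. x \<in> C \<Longrightarrow> c \<odot>\<^bsub>A\<^esub> x \<in> C" "\<And>x y. \<lbrakk>x \<in> C; y \<in> C\<rbrakk> \<Longrightarrow> x \<otimes>\<^bsub>A\<^esub> y \<in> C"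
    "\<And>x. x \<in> C \<Longrightarrow> adj A x \<in> C"
    using C.zero_closed C.add.m_closed C.smult_in C.mult_closed C.adj_closed by simp_all
  have minus: "x \<ominus>\<^bsub>?C\<^esub> y = x \<ominus>\<^bsub>A\<^esub> y" if "x \<in> C" "y \<in> C" for x y
    using C.minus_eq_smult[of x y] A.minus_eq_smult[of x y] that subsetD[OF sub] by simp
  show "x \<in> C" if s: "\<And>n. s n \<in> C" and x: "x \<in> carrier A" and lim: "A.tends s x" for s x
  proof -
    have sA: "s n \<in> carrier A" for n
      using s sub by blast
    have "\<exists>N. \<forall>m\<ge>N. \<forall>n\<ge>N. cnorm A (s m \<ominus>\<^bsub>?C\<^esub> s n) < e" if "e > 0" for e
      using A.tends_Cauchy[OF lim sA x that] s by (simp add: minus)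
    then obtain y where y: "y \<in> C" "(\<lambda>n. cnorm A (s n \<ominus>\<^bsub>?C\<^esub> y)) \<longlonglongrightarrow> 0"
      using C.complete[of s] s by auto
    then have "A.tends s y"
      by (simp add: A.tends_def minus s)
    then have "x = y"
      using A.tends_unique[OF lim _ sA x] sub y(1) by blast
    then show ?thesis
      using y(1) by simp
  qed
qed

lemma cstar_subalgebraI:
  assumes "cstar_algebra A"
    and sub: "C \<subseteq> carrier A" and zero: "\<zero>\<^bsub>A\<^esub> \<in> C"
    and add: "\<And>x y. \<lbrakk>x \<in> C; y \<in> C\<rbrakk> \<Longrightarrow> x \<oplus>\<^bsub>A\<^esub> y \<in> C"
    and smult: "\<And>c x. x \<in> C \<Longrightarrow> c \<odot>\<^bsub>A\<^esub> x \<in> C"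
    and mult: "\<And>x y. \<lbrakk>x \<in> C; y \<in> C\<rbrakk> \<Longrightarrow> x \<otimes>\<^bsub>A\<^esub> y \<in> C"
    and adj: "\<And>x. x \<in> C \<Longrightarrow> adj A x \<in> C"
    and limits:
      "\<And>s x. \<lbrakk>\<And>n. s n \<in> C; x \<in> carrier A; cstar_algebra.tends A s x\<rbrakk> \<Longrightarrow> x \<in> C"
  shows "cstar_subalgebra C A"
proof -
  interpret A: cstar_algebra A by fact
  let ?C = "A\<lparr>carrier := C\<rparr>"
  have s: "x \<in> carrier A" if "x \<in> C" for x
    using that sub by blast
  have V: "vectorspace class_ring ?C"
    by (rule module_class_ringI)
      (simp_all add: s zero add smult A.a_ac A.smult_add_left A.smult_add_right
        A.smult_smult)
  interpret C: vectorspace class_ring ?C by (rule V)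
  have minus: "x \<ominus>\<^bsub>?C\<^esub> y = x \<ominus>\<^bsub>A\<^esub> y" if "x \<in> C" "y \<in> C" for x y
    using C.smult_l_minus[of 1 y] A.minus_eq_smult[of x y] that s C.smult_one[of y]
    by (simp add: a_minus_def class_ring_simps)
  have "\<exists>x\<in>C. (\<lambda>n. cnorm A (s n \<ominus>\<^bsub>?C\<^esub> x)) \<longlonglongrightarrow> 0"
    if sC: "\<And>n. s n \<in> C"
      and C: "\<And>e. e > 0 \<Longrightarrow> \<exists>N. \<forall>m\<ge>N. \<forall>n\<ge>N. cnorm A (s m \<ominus>\<^bsub>?C\<^esub> s n) < e" for s :: "nat \<Rightarrow> 'a"
  proof -
    obtain x where x: "x \<in> carrier A" "(\<lambda>n. cnorm A (s n \<ominus>\<^bsub>A\<^esub> x)) \<longlonglongrightarrow> 0"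
      using A.complete[OF s[OF sC] C[unfolded minus[OF sC sC]]] by blast
    then have "x \<in> C"
      using limits[OF sC, of x] by (simp add: A.tends_def)
    then show ?thesis
      using x sC by (auto simp: minus)
  qed
  then have "cstar_algebra ?C"
    using V
    by (intro cstar_algebra.intro cstar_algebra_axioms.intro)
      (simp_all add: s zero add smult mult adj A.mult_assoc A.distrib_right A.distrib_left
        A.smult_mult_left A.smult_mult_right A.adj_add A.adj_smult A.adj_mult A.cnorm_nonneg
        A.cnorm_eq_0 A.cnorm_triangle A.cnorm_smult A.cnorm_mult A.cstar_identity)
  then show ?thesis
    using sub by (simp add: cstar_subalgebra_def)
qed

lemma cstar_subalgebra_generated:
  assumes "cstar_algebra A" "v \<in> carrier A"
  shows "cstar_subalgebra (cstar_generated A v) A" "v \<in> cstar_generated A v"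
proof -
  note D = cstar_subalgebraD[OF assms(1)]
  have "cstar_subalgebra (carrier A) A"
    by (simp add: cstar_subalgebra_def assms)
  then have "cstar_generated A v \<subseteq> carrier A"
    using assms(2) unfolding cstar_generated_def by blast
  then show "cstar_subalgebra (cstar_generated A v) A"
    by (rule cstar_subalgebraI[OF assms(1)])
      (unfold cstar_generated_def, (blast intro: D)+)
  show "v \<in> cstar_generated A v"
    by (auto simp: cstar_generated_def)
qed

section \<open>The operator norm of complex matrices\<close>

text \<open>
  The Hilbert space norm appearing in the operator norm, in the form to which the
  inequalities of Minkowski and Cauchy-Schwarz apply.
\<close>

definition vec_l2 :: "complex vec \<Rightarrow> real" where
  "vec_l2 x = L2_set (\<lambda>i. cmod (x $ i)) {..<dim_vec x}"

lemma Re_cscalar_self: "Re (x \<bullet>c x) = (vec_l2 x)\<^sup>2" for x :: "complex vec"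
  by (simp add: vec_l2_def L2_set_def scalar_prod_def sum_nonneg atLeast0LessThan
      cmod_power2 flip: power2_eq_square)

lemma sqrt_cscalar_self: "sqrt (Re (x \<bullet>c x)) = vec_l2 x" for x :: "complex vec"
  by (simp add: Re_cscalar_self vec_l2_def L2_set_nonneg)

lemma cscalar_self_le_1: "Re (x \<bullet>c x) \<le> 1 \<longleftrightarrow> vec_l2 x \<le> 1" for x :: "complex vec"
  by (metis real_sqrt_le_1_iff sqrt_cscalar_self)

lemma vec_l2_nonneg [simp]: "0 \<le> vec_l2 x"
  by (simp add: vec_l2_def L2_set_nonneg)

lemma vec_l2_zero [simp]: "vec_l2 (0\<^sub>v n) = 0"
  by (simp add: vec_l2_def L2_set_def)

lemma cmod_index_le_vec_l2: "i < dim_vec x \<Longrightarrow> cmod (x $ i) \<le> vec_l2 x"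
  unfolding vec_l2_def
  using member_le_L2_set[of "{..<dim_vec x}" i "\<lambda>i. cmod (x $ i)"] by simp

lemma vec_l2_le_sum: "vec_l2 x \<le> (\<Sum>i<dim_vec x. cmod (x $ i))"
  unfolding vec_l2_def by (rule L2_set_le_sum) simp

lemma vec_l2_add: "x \<in> carrier_vec n \<Longrightarrow> y \<in> carrier_vec n \<Longrightarrow> vec_l2 (x + y) \<le> vec_l2 x + vec_l2 y"
proof -
  assume xy: "x \<in> carrier_vec n" "y \<in> carrier_vec n"
  then have "vec_l2 (x + y) \<le> L2_set (\<lambda>i. cmod (x $ i) + cmod (y $ i)) {..<n}"
    by (auto simp: vec_l2_def intro!: L2_set_mono norm_triangle_ineq)
  also have "\<dots> \<le> vec_l2 x + vec_l2 y"
    using xy L2_set_triangle_ineq[of "\<lambda>i. cmod (x $ i)" "\<lambda>i. cmod (y $ i)" "{..<n}"]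
    by (simp add: vec_l2_def)
  finally show ?thesis .
qed

lemma vec_l2_smult: "vec_l2 (c \<cdot>\<^sub>v x) = cmod c * vec_l2 x"
proof -
  have "vec_l2 (c \<cdot>\<^sub>v x) = L2_set (\<lambda>i. cmod c * cmod (x $ i)) {..<dim_vec x}"
    by (auto simp: vec_l2_def norm_mult intro!: L2_set_cong)
  then show ?thesis
    by (simp add: vec_l2_def L2_set_right_distrib)
qed

lemma cmod_cscalar_le:
  assumes "x \<in> carrier_vec n" "y \<in> carrier_vec n"
  shows "cmod (x \<bullet>c y) \<le> vec_l2 x * vec_l2 y"
proof -
  have "cmod (x \<bullet>c y) \<le> (\<Sum>i<n. cmod (x $ i) * cmod (y $ i))"
    using assms
    by (auto simp: scalar_prod_def atLeast0LessThan norm_mult intro!: order.trans[OF norm_sum] sum_mono)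
  also have "\<dots> \<le> vec_l2 x * vec_l2 y"
    using L2_set_mult_ineq[of "\<lambda>i. cmod (x $ i)" "\<lambda>i. cmod (y $ i)" "{..<n}"] assms
    by (simp add: vec_l2_def)
  finally show ?thesis .
qed

lemma mat_adjoint_index [simp]:
  fixes M :: "complex mat"
  shows "i < dim_col M \<Longrightarrow> j < dim_row M \<Longrightarrow> mat_adjoint M $$ (i, j) = cnj (M $$ (j, i))"
  by (simp add: mat_adjoint_def mat_of_rows_def)

lemma mat_adjoint_dim [simp]:
  "dim_row (mat_adjoint M) = dim_col M" "dim_col (mat_adjoint M) = dim_row M"
  by (simp_all add: mat_adjoint_def)

lemma mat_adjoint_carrier [simp, intro]:
  "M \<in> carrier_mat m n \<Longrightarrow> mat_adjoint M \<in> carrier_mat n m"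
  by (intro carrier_matI) auto

lemma mat_adjoint_adjoint [simp]: "mat_adjoint (mat_adjoint M) = M" for M :: "complex mat"
  by (rule eq_matI) auto

lemma mat_adjoint_mult:
  fixes M N :: "complex mat"
  assumes "M \<in> carrier_mat m n" "N \<in> carrier_mat n k"
  shows "mat_adjoint (M * N) = mat_adjoint N * mat_adjoint M"
  using assms by (intro eq_matI) (auto simp: scalar_prod_def mult.commute intro!: sum.cong)

lemma mat_adjoint_add:
  fixes M N :: "complex mat"
  assumes "M \<in> carrier_mat m n" "N \<in> carrier_mat m n"
  shows "mat_adjoint (M + N) = mat_adjoint M + mat_adjoint N"
  using assms by (intro eq_matI) auto

lemma mat_adjoint_smult: "mat_adjoint (c \<cdot>\<^sub>m M) = cnj c \<cdot>\<^sub>m mat_adjoint M" for M :: "complex mat"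
  by (intro eq_matI) auto

lemma cscalar_mat_adjoint:
  fixes M :: "complex mat"
  assumes "M \<in> carrier_mat m n" "x \<in> carrier_vec n" "y \<in> carrier_vec m"
  shows "(M *\<^sub>v x) \<bullet>c y = x \<bullet>c (mat_adjoint M *\<^sub>v y)"
proof -
  have "(M *\<^sub>v x) \<bullet>c y = (\<Sum>i<m. \<Sum>j<n. M $$ (i, j) * x $ j * cnj (y $ i))"
    using assms by (simp add: scalar_prod_def atLeast0LessThan sum_distrib_right)
  also have "\<dots> = (\<Sum>j<n. \<Sum>i<m. M $$ (i, j) * x $ j * cnj (y $ i))"
    by (rule sum.swap)
  also have "\<dots> = x \<bullet>c (mat_adjoint M *\<^sub>v y)"
    using assms by (simp add: scalar_prod_def atLeast0LessThan sum_distrib_left mult_ac)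
  finally show ?thesis .
qed

text \<open>
  A crude bound for the operator norm. It shows that the supremum defining the norm is finite,
  and that entrywise convergence of matrices is convergence in norm.
\<close>

definition entry_sum :: "complex mat \<Rightarrow> real" where
  "entry_sum M = (\<Sum>i<dim_row M. \<Sum>j<dim_col M. cmod (M $$ (i, j)))"

lemma vec_l2_mult_le_entry_sum:
  assumes "x \<in> carrier_vec (dim_col M)" "vec_l2 x \<le> 1"
  shows "vec_l2 (M *\<^sub>v x) \<le> entry_sum M"
proof -
  have "cmod ((M *\<^sub>v x) $ i) \<le> (\<Sum>j<dim_col M. cmod (M $$ (i, j)))" if "i < dim_row M" for i
  proof -
    have x1: "cmod (x $ j) \<le> 1" if "j < dim_col M" for j
      using cmod_index_le_vec_l2[of j x] assms that by simp
    have "cmod ((M *\<^sub>v x) $ i) \<le> (\<Sum>j<dim_col M. cmod (M $$ (i, j)) * cmod (x $ j))"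
      using that assms(1)
      by (auto simp: scalar_prod_def atLeast0LessThan norm_mult intro!: order.trans[OF norm_sum] sum_mono)
    also have "\<dots> \<le> (\<Sum>j<dim_col M. cmod (M $$ (i, j)))"
      using x1 by (intro sum_mono) (simp add: mult_left_le)
    finally show ?thesis .
  qed
  then show ?thesis
    unfolding entry_sum_def
    using order.trans[OF vec_l2_le_sum[of "M *\<^sub>v x"] sum_mono] by simp
qed

lemma mat_opnorm_eq:
  "mat_opnorm M = (SUP x\<in>{x \<in> carrier_vec (dim_col M). vec_l2 x \<le> 1}. vec_l2 (M *\<^sub>v x))"
  by (simp add: mat_opnorm_def sqrt_cscalar_self cscalar_self_le_1)

lemma vec_l2_mult_le_1:
  assumes "x \<in> carrier_vec (dim_col M)" "vec_l2 x \<le> 1"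
  shows "vec_l2 (M *\<^sub>v x) \<le> mat_opnorm M"
  unfolding mat_opnorm_eq
  by (rule cSUP_upper) (use assms vec_l2_mult_le_entry_sum in \<open>auto intro!: bdd_aboveI2\<close>)

lemma mat_opnorm_least:
  assumes "\<And>x. \<lbrakk>x \<in> carrier_vec (dim_col M); vec_l2 x \<le> 1\<rbrakk> \<Longrightarrow> vec_l2 (M *\<^sub>v x) \<le> K"
  shows "mat_opnorm M \<le> K"
proof -
  have "0\<^sub>v (dim_col M) \<in> {x \<in> carrier_vec (dim_col M). vec_l2 x \<le> 1}"
    by simp
  then show ?thesis
    unfolding mat_opnorm_eq using assms by (intro cSUP_least) blast+
qed

lemma mat_opnorm_nonneg [simp]: "0 \<le> mat_opnorm M"
  using order.trans[OF vec_l2_nonneg vec_l2_mult_le_1[of "0\<^sub>v (dim_col M)" M]] by simp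

lemma mat_opnorm_le_entry_sum: "mat_opnorm M \<le> entry_sum M"
  by (rule mat_opnorm_least) (rule vec_l2_mult_le_entry_sum)

lemma vec_l2_mult_le:
  assumes "x \<in> carrier_vec (dim_col M)"
  shows "vec_l2 (M *\<^sub>v x) \<le> mat_opnorm M * vec_l2 x"
proof (cases "vec_l2 x = 0")
  case True
  have "x $ i = 0" if "i < dim_vec x" for i
    using cmod_index_le_vec_l2[OF that] True by simp
  then have "M *\<^sub>v x = 0\<^sub>v (dim_row M)"
    using assms by (intro eq_vecI) (auto simp: scalar_prod_def)
  then show ?thesis
    using True by simp
next
  case False
  define r where "r = vec_l2 x"
  have r: "r > 0" using False by (simp add: r_def order_less_le)
  let ?y = "complex_of_real (inverse r) \<cdot>\<^sub>v x"
  have "vec_l2 ?y \<le> 1"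
    using r by (simp add: vec_l2_smult norm_inverse flip: r_def)
  then have "vec_l2 (M *\<^sub>v ?y) \<le> mat_opnorm M"
    using assms by (intro vec_l2_mult_le_1) auto
  moreover have "M *\<^sub>v ?y = complex_of_real (inverse r) \<cdot>\<^sub>v (M *\<^sub>v x)"
    using assms mult_mat_vec[of M "dim_row M" "dim_col M" x] by auto
  ultimately show ?thesis
    using r by (simp add: vec_l2_smult norm_inverse norm_divide field_simps flip: r_def)
qed

lemma cmod_entry_le_mat_opnorm:
  assumes "i < dim_row M" "j < dim_col M"
  shows "cmod (M $$ (i, j)) \<le> mat_opnorm M"
proof -
  let ?u = "unit_vec (dim_col M) j :: complex vec"
  have "vec_l2 ?u \<le> 1"
    using assms(2) by (simp flip: cscalar_self_le_1)
  then have "vec_l2 (M *\<^sub>v ?u) \<le> mat_opnorm M"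
    by (intro vec_l2_mult_le_1) auto
  moreover have "(M *\<^sub>v ?u) $ i = M $$ (i, j)"
    using assms by simp
  ultimately show ?thesis
    using cmod_index_le_vec_l2[of i "M *\<^sub>v ?u"] assms by simp
qed

lemma mat_opnorm_add:
  assumes "M \<in> carrier_mat m n" "N \<in> carrier_mat m n"
  shows "mat_opnorm (M + N) \<le> mat_opnorm M + mat_opnorm N"
proof (rule mat_opnorm_least)
  fix x assume x: "x \<in> carrier_vec (dim_col (M + N))" "vec_l2 x \<le> 1"
  have "vec_l2 ((M + N) *\<^sub>v x) = vec_l2 (M *\<^sub>v x + N *\<^sub>v x)"
    using x assms by (subst add_mult_distrib_mat_vec[OF assms]) auto
  also have "\<dots> \<le> vec_l2 (M *\<^sub>v x) + vec_l2 (N *\<^sub>v x)"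
    using assms by (intro vec_l2_add[of _ m]) (auto intro: carrier_vecI)
  also have "\<dots> \<le> mat_opnorm M + mat_opnorm N"
    using assms x by (intro add_mono vec_l2_mult_le_1) auto
  finally show "vec_l2 ((M + N) *\<^sub>v x) \<le> mat_opnorm M + mat_opnorm N" .
qed

lemma mat_opnorm_smult: "mat_opnorm (c \<cdot>\<^sub>m M) = cmod c * mat_opnorm M"
proof -
  have le: "mat_opnorm (d \<cdot>\<^sub>m N) \<le> cmod d * mat_opnorm N" for d N
  proof (rule mat_opnorm_least)
    fix x assume x: "x \<in> carrier_vec (dim_col (d \<cdot>\<^sub>m N))" "vec_l2 x \<le> 1"
    have "(d \<cdot>\<^sub>m N) *\<^sub>v x = d \<cdot>\<^sub>v (N *\<^sub>v x)"
      using x by (intro eq_vecI) auto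
    then show "vec_l2 ((d \<cdot>\<^sub>m N) *\<^sub>v x) \<le> cmod d * mat_opnorm N"
      using x vec_l2_mult_le_1[of x N] by (simp add: vec_l2_smult mult_left_mono)
  qed
  show ?thesis
  proof (cases "c = 0")
    case True
    then show ?thesis using le[of 0 M] mat_opnorm_nonneg[of "0 \<cdot>\<^sub>m M"] by simp
  next
    case False
    have "inverse c \<cdot>\<^sub>m (c \<cdot>\<^sub>m M) = M"
      using False by (intro eq_matI) auto
    then have "mat_opnorm M \<le> cmod (inverse c) * mat_opnorm (c \<cdot>\<^sub>m M)"
      using le[of "inverse c" "c \<cdot>\<^sub>m M"] by simp
    then have "cmod c * mat_opnorm M \<le> mat_opnorm (c \<cdot>\<^sub>m M)"
      using False by (simp add: norm_inverse field_simps norm_divide)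
    then show ?thesis using le[of c M] by simp
  qed
qed

lemma mat_opnorm_mult:
  assumes "M \<in> carrier_mat m n" "N \<in> carrier_mat n k"
  shows "mat_opnorm (M * N) \<le> mat_opnorm M * mat_opnorm N"
proof (rule mat_opnorm_least)
  fix x assume x: "x \<in> carrier_vec (dim_col (M * N))" "vec_l2 x \<le> 1"
  have "vec_l2 ((M * N) *\<^sub>v x) = vec_l2 (M *\<^sub>v (N *\<^sub>v x))"
    using x assms by (subst assoc_mult_mat_vec[OF assms]) auto
  also have "\<dots> \<le> mat_opnorm M * vec_l2 (N *\<^sub>v x)"
    using assms by (intro vec_l2_mult_le) (auto intro: carrier_vecI)
  also have "\<dots> \<le> mat_opnorm M * mat_opnorm N"
    using assms x by (intro mult_left_mono vec_l2_mult_le_1) auto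
  finally show "vec_l2 ((M * N) *\<^sub>v x) \<le> mat_opnorm M * mat_opnorm N" .
qed

text \<open>
  From \<open>\<parallel>N x\<parallel>\<^sup>2 = \<langle>x, N\<^sup>* N x\<rangle>\<close> one gets \<open>\<parallel>N\<parallel>\<^sup>2 \<le> \<parallel>N\<^sup>* N\<parallel> \<le> \<parallel>N\<^sup>*\<parallel> \<parallel>N\<parallel>\<close>, so \<open>\<parallel>N\<parallel> \<le> \<parallel>N\<^sup>*\<parallel>\<close>. Applied to
  the adjoint of \<open>N\<close> as well, this gives equality everywhere.
\<close>

lemma mat_opnorm_adjoint [simp]: "mat_opnorm (mat_adjoint M) = mat_opnorm M"
  and mat_opnorm_adjoint_mult: "mat_opnorm (mat_adjoint M * M) = (mat_opnorm M)\<^sup>2"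
proof -
  have ge: "(mat_opnorm N)\<^sup>2 \<le> mat_opnorm (mat_adjoint N * N)" for N
  proof -
    have "mat_opnorm N \<le> sqrt (mat_opnorm (mat_adjoint N * N))"
    proof (rule mat_opnorm_least)
      fix x assume x: "x \<in> carrier_vec (dim_col N)" "vec_l2 x \<le> 1"
      have N: "N \<in> carrier_mat (dim_row N) (dim_col N)" by simp
      let ?y = "(mat_adjoint N * N) *\<^sub>v x"
      have "(vec_l2 (N *\<^sub>v x))\<^sup>2 = Re (x \<bullet>c (mat_adjoint N *\<^sub>v (N *\<^sub>v x)))"
        unfolding Re_cscalar_self[symmetric]
        by (intro arg_cong[of _ _ Re] cscalar_mat_adjoint[OF N x(1)] carrier_vecI) simp
      also have "mat_adjoint N *\<^sub>v (N *\<^sub>v x) = ?y"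
        using x by (subst assoc_mult_mat_vec[OF mat_adjoint_carrier[OF N] N]) auto
      also have "Re (x \<bullet>c ?y) \<le> vec_l2 x * vec_l2 ?y"
        using x by (intro order.trans[OF complex_Re_le_cmod] cmod_cscalar_le[of _ "dim_col N"])
          (auto intro!: carrier_vecI)
      also have "\<dots> \<le> 1 * mat_opnorm (mat_adjoint N * N)"
        using x by (intro mult_mono vec_l2_mult_le_1) auto
      finally show "vec_l2 (N *\<^sub>v x) \<le> sqrt (mat_opnorm (mat_adjoint N * N))"
        by (simp add: real_le_rsqrt)
    qed
    then have "(mat_opnorm N)\<^sup>2 \<le> (sqrt (mat_opnorm (mat_adjoint N * N)))\<^sup>2"
      by (rule power_mono) simp
    then show ?thesis by simp
  qed
  have le: "mat_opnorm N \<le> mat_opnorm (mat_adjoint N)" for N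
  proof (cases "mat_opnorm N = 0")
    case False
    have N: "N \<in> carrier_mat (dim_row N) (dim_col N)" by simp
    have "(mat_opnorm N)\<^sup>2 \<le> mat_opnorm (mat_adjoint N) * mat_opnorm N"
      using order.trans[OF ge[of N] mat_opnorm_mult[OF mat_adjoint_carrier[OF N] N]] .
    moreover have "0 < mat_opnorm N"
      using False mat_opnorm_nonneg[of N] by linarith
    ultimately show ?thesis
      by (simp add: power2_eq_square)
  qed simp
  show "mat_opnorm (mat_adjoint M) = mat_opnorm M"
    using le[of M] le[of "mat_adjoint M"] by simp
  then have "mat_opnorm (mat_adjoint M * M) \<le> (mat_opnorm M)\<^sup>2"
    using mat_opnorm_mult[of "mat_adjoint M" "dim_col M" "dim_row M" M "dim_col M"]
    by (simp only: mat_adjoint_carrier carrier_mat_triv power2_eq_square simp_thms)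
  then show "mat_opnorm (mat_adjoint M * M) = (mat_opnorm M)\<^sup>2"
    using ge[of M] by (rule antisym)
qed

section \<open>The C*-algebra of bounded matrix sequences\<close>

lemma mat_seq_simps [simp]:
  "zero mat_seq_algebra = (\<lambda>n. 0\<^sub>m n n)"
  "add mat_seq_algebra = (\<lambda>M N n. M n + N n)"
  "monoid.mult mat_seq_algebra = (\<lambda>M N n. M n * N n)"
  "module.smult mat_seq_algebra = (\<lambda>c M n. c \<cdot>\<^sub>m M n)"
  "adj mat_seq_algebra = (\<lambda>M n. mat_adjoint (M n))"
  by (simp_all add: mat_seq_algebra_def)

lemma mat_seqI:
  assumes "\<And>n. M n \<in> carrier_mat n n" "\<And>n. n \<ge> 1 \<Longrightarrow> mat_opnorm (M n) \<le> K"
  shows "M \<in> carrier mat_seq_algebra" and "cnorm mat_seq_algebra M \<le> K"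
  using assms by (auto simp: mat_seq_algebra_def intro!: bdd_aboveI2[of _ _ K] cSUP_least)

lemma mat_seq_carrier_mat:
  "M \<in> carrier mat_seq_algebra \<Longrightarrow> M n \<in> carrier_mat n n"
  by (simp add: mat_seq_algebra_def)

lemma mat_opnorm_le_cnorm:
  "M \<in> carrier mat_seq_algebra \<Longrightarrow> n \<ge> 1 \<Longrightarrow> mat_opnorm (M n) \<le> cnorm mat_seq_algebra M"
  by (auto simp: mat_seq_algebra_def intro: cSUP_upper)

lemma cmod_entry_le_cnorm:
  assumes "M \<in> carrier mat_seq_algebra" "i < n" "j < n"
  shows "cmod (M n $$ (i, j)) \<le> cnorm mat_seq_algebra M"
  using cmod_entry_le_mat_opnorm[of i "M n" j] mat_opnorm_le_cnorm[OF assms(1), of n]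
    mat_seq_carrier_mat[OF assms(1), of n] assms(2,3) by simp

lemma mat_seq_cnorm_nonneg:
  "M \<in> carrier mat_seq_algebra \<Longrightarrow> 0 \<le> cnorm mat_seq_algebra M"
  using order.trans[OF mat_opnorm_nonneg mat_opnorm_le_cnorm[of M 1]] by simp

lemma mat_seq_eqI:
  assumes "M \<in> carrier mat_seq_algebra" "N \<in> carrier mat_seq_algebra"
    and "\<And>n i j. \<lbrakk>i < n; j < n\<rbrakk> \<Longrightarrow> M n $$ (i, j) = N n $$ (i, j)"
  shows "M = N"
  using mat_seq_carrier_mat[OF assms(1), THEN carrier_matD(1)]
    mat_seq_carrier_mat[OF assms(1), THEN carrier_matD(2)]
    mat_seq_carrier_mat[OF assms(2), THEN carrier_matD(1)]
    mat_seq_carrier_mat[OF assms(2), THEN carrier_matD(2)] assms(3)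
  by (intro ext eq_matI) simp_all

lemma mat_opnorm_zero [simp]: "mat_opnorm (0\<^sub>m m n) = 0"
  using mat_opnorm_le_entry_sum[of "0\<^sub>m m n"] mat_opnorm_nonneg[of "0\<^sub>m m n"]
  by (simp add: entry_sum_def)

lemma mat_seq_zero_closed: "(\<lambda>n. 0\<^sub>m n n) \<in> carrier mat_seq_algebra"
  by (rule mat_seqI(1)[of _ 0]) simp_all

text \<open>
  A bound that is uniform in the blocks yields membership and the norm estimate at once.
\<close>

lemma mat_seq_closed:
  assumes M: "M \<in> carrier mat_seq_algebra"
  shows "N \<in> carrier mat_seq_algebra \<Longrightarrow> (\<lambda>n. M n + N n) \<in> carrier mat_seq_algebra"
    and "N \<in> carrier mat_seq_algebra \<Longrightarrow> (\<lambda>n. M n * N n) \<in> carrier mat_seq_algebra"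
    and "(\<lambda>n. c \<cdot>\<^sub>m M n) \<in> carrier mat_seq_algebra"
    and "(\<lambda>n. mat_adjoint (M n)) \<in> carrier mat_seq_algebra"
    and "N \<in> carrier mat_seq_algebra \<Longrightarrow> cnorm mat_seq_algebra (\<lambda>n. M n + N n)
      \<le> cnorm mat_seq_algebra M + cnorm mat_seq_algebra N"
    and "N \<in> carrier mat_seq_algebra \<Longrightarrow> cnorm mat_seq_algebra (\<lambda>n. M n * N n)
      \<le> cnorm mat_seq_algebra M * cnorm mat_seq_algebra N"
    and "cnorm mat_seq_algebra (\<lambda>n. c \<cdot>\<^sub>m M n) \<le> cmod c * cnorm mat_seq_algebra M"
    and "cnorm mat_seq_algebra (\<lambda>n. mat_adjoint (M n)) \<le> cnorm mat_seq_algebra M"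
proof -
  note mats = mat_seq_carrier_mat[OF M] and le = mat_opnorm_le_cnorm[OF M]
  show "(\<lambda>n. c \<cdot>\<^sub>m M n) \<in> carrier mat_seq_algebra"
    "cnorm mat_seq_algebra (\<lambda>n. c \<cdot>\<^sub>m M n) \<le> cmod c * cnorm mat_seq_algebra M"
    by (rule mat_seqI[where K = "cmod c * cnorm mat_seq_algebra M"];
        use mats in \<open>simp add: mat_opnorm_smult le mult_left_mono\<close>)+
  show "(\<lambda>n. mat_adjoint (M n)) \<in> carrier mat_seq_algebra"
    "cnorm mat_seq_algebra (\<lambda>n. mat_adjoint (M n)) \<le> cnorm mat_seq_algebra M"
    by (rule mat_seqI[where K = "cnorm mat_seq_algebra M"];
        use mats in \<open>simp add: mat_opnorm_adjoint le\<close>)+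
  assume N: "N \<in> carrier mat_seq_algebra"
  note mats' = mat_seq_carrier_mat[OF N] and le' = mat_opnorm_le_cnorm[OF N]
  have add: "mat_opnorm (M n + N n) \<le> cnorm mat_seq_algebra M + cnorm mat_seq_algebra N"
    if "n \<ge> 1" for n
    using mat_opnorm_add[OF mats mats', of n] le[OF that] le'[OF that] by simp
  show "(\<lambda>n. M n + N n) \<in> carrier mat_seq_algebra"
    "cnorm mat_seq_algebra (\<lambda>n. M n + N n) \<le> cnorm mat_seq_algebra M + cnorm mat_seq_algebra N"
    using mat_seqI[OF add_carrier_mat[OF mats'] add] by blast+
  have mult: "mat_opnorm (M n * N n) \<le> cnorm mat_seq_algebra M * cnorm mat_seq_algebra N"
    if "n \<ge> 1" for n
    using mult_mono[OF le[OF that] le'[OF that] mat_seq_cnorm_nonneg[OF M] mat_opnorm_nonneg]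
      mat_opnorm_mult[OF mats mats', of n] by simp
  show "(\<lambda>n. M n * N n) \<in> carrier mat_seq_algebra"
    "cnorm mat_seq_algebra (\<lambda>n. M n * N n) \<le> cnorm mat_seq_algebra M * cnorm mat_seq_algebra N"
    using mat_seqI[OF mult_carrier_mat[OF mats mats'] mult] by blast+
qed

text \<open>
  Entries are dominated by the norm, so they converge in each block. That the convergence is
  uniform in the block is seen by letting the second index of the Cauchy condition tend to
  infinity, which is harmless since each single block is finite-dimensional.
\<close>

lemma mat_seq_complete:
  assumes s: "\<And>k. s k \<in> carrier mat_seq_algebra"
    and Cauchy: "\<And>e. e > 0 \<Longrightarrow>
      \<exists>N. \<forall>k\<ge>N. \<forall>l\<ge>N. cnorm mat_seq_algebra (\<lambda>n. s k n + (-1) \<cdot>\<^sub>m s l n) < e"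
  shows "\<exists>M\<in>carrier mat_seq_algebra.
    (\<lambda>k. cnorm mat_seq_algebra (\<lambda>n. s k n + (-1) \<cdot>\<^sub>m M n)) \<longlonglongrightarrow> 0"
proof -
  note mats = mat_seq_carrier_mat[OF s]
  let ?d = "\<lambda>M N n. M n + (-1) \<cdot>\<^sub>m (N n :: complex mat)"
  have d: "?d M N \<in> carrier mat_seq_algebra"
    if "M \<in> carrier mat_seq_algebra" "N \<in> carrier mat_seq_algebra" for M N
    using mat_seq_closed(1)[OF that(1) mat_seq_closed(3)[OF that(2), of "-1"]] by simp
  have entry: "convergent (\<lambda>k. s k n $$ (i, j))" if "i < n" "j < n" for n i j
  proof (rule Cauchy_convergent, rule metric_CauchyI)
    fix e :: real assume "e > 0"
    from Cauchy[OF this] obtain N where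
      N: "\<And>k l. k \<ge> N \<Longrightarrow> l \<ge> N \<Longrightarrow> cnorm mat_seq_algebra (?d (s k) (s l)) < e"
      by blast
    have "dist (s k n $$ (i, j)) (s l n $$ (i, j)) < e" if "k \<ge> N" "l \<ge> N" for k l
      using order.strict_trans1[OF cmod_entry_le_cnorm[OF d[OF s[of k] s[of l]], of i n j] N[OF that]]
        \<open>i < n\<close> \<open>j < n\<close> mats[of k n] mats[of l n] by (simp add: dist_norm)
    then show "\<exists>N. \<forall>k\<ge>N. \<forall>l\<ge>N. dist (s k n $$ (i, j)) (s l n $$ (i, j)) < e"
      by blast
  qed
  define L where "L n = mat n n (\<lambda>(i, j). lim (\<lambda>k. s k n $$ (i, j)))" for n
  have L: "L n \<in> carrier_mat n n" for n
    by (simp add: L_def)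
  have block: "(\<lambda>l. mat_opnorm (s l n + (-1) \<cdot>\<^sub>m L n)) \<longlonglongrightarrow> 0" for n
  proof -
    have "(\<lambda>l. cmod (s l n $$ (i, j) - L n $$ (i, j))) \<longlonglongrightarrow> 0" if "i < n" "j < n" for i j
      using entry[OF that] that
      by (auto simp: L_def convergent_LIMSEQ_iff intro!: tendsto_norm_zero LIM_zero)
    then have lim: "(\<lambda>l. \<Sum>i<n. \<Sum>j<n. cmod (s l n $$ (i, j) - L n $$ (i, j))) \<longlonglongrightarrow> 0"
      by (intro tendsto_null_sum) auto
    have "mat_opnorm (s l n + (-1) \<cdot>\<^sub>m L n)
        \<le> (\<Sum>i<n. \<Sum>j<n. cmod (s l n $$ (i, j) - L n $$ (i, j)))" for l
      using mat_opnorm_le_entry_sum[of "s l n + (-1) \<cdot>\<^sub>m L n"] mats[of l n] L[of n]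
      by (simp add: entry_sum_def)
    then show ?thesis
      by (intro tendsto_sandwich[OF _ _ tendsto_const lim]) simp_all
  qed
  have uniform: "mat_opnorm (s k n + (-1) \<cdot>\<^sub>m L n) \<le> e"
    if N: "\<And>k l. k \<ge> N \<Longrightarrow> l \<ge> N \<Longrightarrow> cnorm mat_seq_algebra (?d (s k) (s l)) < e"
      and "k \<ge> N" "n \<ge> 1" for e N k n
  proof (rule LIMSEQ_le_const)
    show "(\<lambda>l. e + mat_opnorm (s l n + (-1) \<cdot>\<^sub>m L n)) \<longlonglongrightarrow> e"
      using tendsto_add[OF tendsto_const block] by simp
    have "mat_opnorm (s k n + (-1) \<cdot>\<^sub>m L n) \<le> e + mat_opnorm (s l n + (-1) \<cdot>\<^sub>m L n)"
      if "l \<ge> N" for l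
    proof -
      have "s k n + (-1) \<cdot>\<^sub>m L n = ?d (s k) (s l) n + (s l n + (-1) \<cdot>\<^sub>m L n)"
        using mats[of k n] mats[of l n] L[of n] by (intro eq_matI) auto
      also have "mat_opnorm \<dots> \<le> mat_opnorm (?d (s k) (s l) n) + mat_opnorm (s l n + (-1) \<cdot>\<^sub>m L n)"
        using mats[of k n] mats[of l n] L[of n] by (intro mat_opnorm_add[of _ n n]) auto
      finally show ?thesis
        using mat_opnorm_le_cnorm[OF d[OF s[of k] s[of l]] \<open>n \<ge> 1\<close>] N[OF \<open>k \<ge> N\<close> that] by simp
    qed
    then show "\<exists>N. \<forall>l\<ge>N. mat_opnorm (s k n + (-1) \<cdot>\<^sub>m L n)
        \<le> e + mat_opnorm (s l n + (-1) \<cdot>\<^sub>m L n)"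
      by blast
  qed
  have dL: "?d (s k) L \<in> carrier mat_seq_algebra \<and> cnorm mat_seq_algebra (?d (s k) L) \<le> e"
    if "\<And>k l. k \<ge> N \<Longrightarrow> l \<ge> N \<Longrightarrow> cnorm mat_seq_algebra (?d (s k) (s l)) < e" "k \<ge> N" for e N k
    using mat_seqI[of "?d (s k) L" e] uniform[OF that] mats L by (auto intro!: add_carrier_mat)
  have "L \<in> carrier mat_seq_algebra"
  proof -
    obtain N where "\<And>k l. k \<ge> N \<Longrightarrow> l \<ge> N \<Longrightarrow> cnorm mat_seq_algebra (?d (s k) (s l)) < 1"
      using Cauchy[of 1] by auto
    \<comment> \<open>\<open>L\<close> is bounded as the difference of two bounded sequences.\<close>
    then have "?d (s N) (?d (s N) L) \<in> carrier mat_seq_algebra"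
      using d[OF s dL[THEN conjunct1]] by blast
    moreover have "?d (s N) (?d (s N) L) = L"
      using mats L by (intro ext eq_matI) auto
    ultimately show ?thesis by simp
  qed
  moreover have "(\<lambda>k. cnorm mat_seq_algebra (?d (s k) L)) \<longlonglongrightarrow> 0"
  proof (rule LIMSEQ_I)
    fix e :: real assume "e > 0"
    then obtain N where
      N: "\<And>k l. k \<ge> N \<Longrightarrow> l \<ge> N \<Longrightarrow> cnorm mat_seq_algebra (?d (s k) (s l)) < e / 2"
      using Cauchy[of "e / 2"] by auto
    have "norm (cnorm mat_seq_algebra (?d (s k) L) - 0) < e" if "k \<ge> N" for k
      using dL[OF N that] mat_seq_cnorm_nonneg[of "?d (s k) L"] \<open>e > 0\<close> by auto
    then show "\<exists>N. \<forall>k\<ge>N. norm (cnorm mat_seq_algebra (?d (s k) L) - 0) < e"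
      by blast
  qed
  ultimately show ?thesis by blast
qed

lemma mat_seq_vectorspace: "vectorspace class_ring mat_seq_algebra"
proof (rule module_class_ringI)
  fix x y z assume "x \<in> carrier mat_seq_algebra" "y \<in> carrier mat_seq_algebra" "z \<in> carrier mat_seq_algebra"
  note m = mat_seq_carrier_mat[OF this(1)] mat_seq_carrier_mat[OF this(2)] mat_seq_carrier_mat[OF this(3)]
  show "(x \<oplus>\<^bsub>mat_seq_algebra\<^esub> y) \<oplus>\<^bsub>mat_seq_algebra\<^esub> z = x \<oplus>\<^bsub>mat_seq_algebra\<^esub> (y \<oplus>\<^bsub>mat_seq_algebra\<^esub> z)"
    using assoc_add_mat[OF m] by simp
next
  fix x y and c d :: complex assume "x \<in> carrier mat_seq_algebra" "y \<in> carrier mat_seq_algebra"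
  note m = mat_seq_carrier_mat[OF this(1)] mat_seq_carrier_mat[OF this(2)]
  show "x \<oplus>\<^bsub>mat_seq_algebra\<^esub> y = y \<oplus>\<^bsub>mat_seq_algebra\<^esub> x"
    using comm_add_mat[OF m] by simp
  show "c \<odot>\<^bsub>mat_seq_algebra\<^esub> (x \<oplus>\<^bsub>mat_seq_algebra\<^esub> y) = c \<odot>\<^bsub>mat_seq_algebra\<^esub> x \<oplus>\<^bsub>mat_seq_algebra\<^esub> c \<odot>\<^bsub>mat_seq_algebra\<^esub> y"
    using add_smult_distrib_left_mat[OF m] by simp
  show "\<zero>\<^bsub>mat_seq_algebra\<^esub> \<oplus>\<^bsub>mat_seq_algebra\<^esub> x = x"
    using left_add_zero_mat[OF m(1)] by simp
  show "(c + d) \<odot>\<^bsub>mat_seq_algebra\<^esub> x = c \<odot>\<^bsub>mat_seq_algebra\<^esub> x \<oplus>\<^bsub>mat_seq_algebra\<^esub> d \<odot>\<^bsub>mat_seq_algebra\<^esub> x"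
    using add_smult_distrib_right_mat[OF m(1)] by simp
  show "(c * d) \<odot>\<^bsub>mat_seq_algebra\<^esub> x = c \<odot>\<^bsub>mat_seq_algebra\<^esub> (d \<odot>\<^bsub>mat_seq_algebra\<^esub> x)"
    by (auto intro!: ext eq_matI)
  show "0 \<odot>\<^bsub>mat_seq_algebra\<^esub> x = \<zero>\<^bsub>mat_seq_algebra\<^esub>" "1 \<odot>\<^bsub>mat_seq_algebra\<^esub> x = x"
    using m(1)[THEN carrier_matD(1)] m(1)[THEN carrier_matD(2)] by (auto intro!: ext eq_matI)
qed (simp_all add: mat_seq_zero_closed mat_seq_closed)

theorem cstar_algebra_mat_seq: "cstar_algebra mat_seq_algebra"
proof -
  let ?F = mat_seq_algebra
  note mats = mat_seq_carrier_mat
  have dims: "dim_row (M n) = n" "dim_col (M n) = n" if "M \<in> carrier ?F" for M n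
    using mats[OF that, of n] by simp_all
  interpret vectorspace class_ring ?F by (rule mat_seq_vectorspace)
  have minus: "M \<ominus>\<^bsub>?F\<^esub> N = (\<lambda>n. M n + (-1) \<cdot>\<^sub>m N n)"
    if "M \<in> carrier ?F" "N \<in> carrier ?F" for M N
  proof -
    have "\<ominus>\<^bsub>?F\<^esub> N = (\<lambda>n. (-1) \<cdot>\<^sub>m N n)"
      using smult_l_minus[of 1 N] smult_one[of N] that(2) by (simp add: class_ring_simps)
    then show ?thesis by (simp add: a_minus_def)
  qed
  have norm0: "M = (\<lambda>n. 0\<^sub>m n n)" if "M \<in> carrier ?F" "cnorm ?F M = 0" for M
    using cmod_entry_le_cnorm[OF that(1)] that(2)
    by (intro mat_seq_eqI that(1) mat_seq_zero_closed) simp_all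
  have smult: "cnorm ?F (\<lambda>n. c \<cdot>\<^sub>m M n) = cmod c * cnorm ?F M" if M: "M \<in> carrier ?F" for M c
  proof (cases "c = 0")
    case True
    then show ?thesis
      using mat_seq_closed(7)[OF M, of 0] mat_seq_cnorm_nonneg[OF mat_seq_closed(3)[OF M, of 0]]
      by simp
  next
    case False
    have "(\<lambda>n. inverse c \<cdot>\<^sub>m (c \<cdot>\<^sub>m M n)) = M"
      using False by (intro ext eq_matI) auto
    then have "cnorm ?F M \<le> cmod (inverse c) * cnorm ?F (\<lambda>n. c \<cdot>\<^sub>m M n)"
      using mat_seq_closed(7)[OF mat_seq_closed(3)[OF M, of c], of "inverse c"] by simp
    then have "cmod c * cnorm ?F M \<le> cnorm ?F (\<lambda>n. c \<cdot>\<^sub>m M n)"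
      using False by (simp add: norm_inverse norm_divide field_simps)
    then show ?thesis
      using mat_seq_closed(7)[OF M, of c] by simp
  qed
  have star: "cnorm ?F (\<lambda>n. mat_adjoint (M n) * M n) = (cnorm ?F M)\<^sup>2" if M: "M \<in> carrier ?F" for M
  proof (rule antisym)
    note M' = mat_seq_closed(4)[OF M]
    show "cnorm ?F (\<lambda>n. mat_adjoint (M n) * M n) \<le> (cnorm ?F M)\<^sup>2"
      using mat_seq_closed(6)[OF M' M] mult_right_mono[OF mat_seq_closed(8)[OF M] mat_seq_cnorm_nonneg[OF M]]
      by (simp add: power2_eq_square)
    have "mat_opnorm (M n) \<le> sqrt (cnorm ?F (\<lambda>n. mat_adjoint (M n) * M n))" if "n \<ge> 1" for n
      using mat_opnorm_le_cnorm[OF mat_seq_closed(2)[OF M' M] that]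
        mat_opnorm_adjoint_mult[of "M n"] by (intro real_le_rsqrt) simp
    then have "cnorm ?F M \<le> sqrt (cnorm ?F (\<lambda>n. mat_adjoint (M n) * M n))"
      by (intro mat_seqI(2) mats[OF M])
    then have "(cnorm ?F M)\<^sup>2 \<le> (sqrt (cnorm ?F (\<lambda>n. mat_adjoint (M n) * M n)))\<^sup>2"
      by (rule power_mono) (rule mat_seq_cnorm_nonneg[OF M])
    then show "(cnorm ?F M)\<^sup>2 \<le> cnorm ?F (\<lambda>n. mat_adjoint (M n) * M n)"
      using mat_seq_cnorm_nonneg[OF mat_seq_closed(2)[OF M' M]] by simp
  qed
  have cnorm_zero: "cnorm ?F (\<lambda>n. 0\<^sub>m n n) = 0"
    using mat_seqI(2)[of "\<lambda>n. 0\<^sub>m n n" 0] mat_seq_cnorm_nonneg[OF mat_seq_zero_closed] by simp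
  show ?thesis
  proof (intro cstar_algebra.intro mat_seq_vectorspace cstar_algebra_axioms.intro)
    fix x y z assume "x \<in> carrier ?F" "y \<in> carrier ?F" "z \<in> carrier ?F"
    note m = mats[OF this(1)] mats[OF this(2)] mats[OF this(3)]
    show "(x \<otimes>\<^bsub>?F\<^esub> y) \<otimes>\<^bsub>?F\<^esub> z = x \<otimes>\<^bsub>?F\<^esub> (y \<otimes>\<^bsub>?F\<^esub> z)"
      using assoc_mult_mat[OF m] by simp
    show "(x \<oplus>\<^bsub>?F\<^esub> y) \<otimes>\<^bsub>?F\<^esub> z = x \<otimes>\<^bsub>?F\<^esub> z \<oplus>\<^bsub>?F\<^esub> y \<otimes>\<^bsub>?F\<^esub> z"
      using add_mult_distrib_mat[OF m] by simp
    show "x \<otimes>\<^bsub>?F\<^esub> (y \<oplus>\<^bsub>?F\<^esub> z) = x \<otimes>\<^bsub>?F\<^esub> y \<oplus>\<^bsub>?F\<^esub> x \<otimes>\<^bsub>?F\<^esub> z"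
      using mult_add_distrib_mat[OF m] by simp
  next
    fix x y c assume "x \<in> carrier ?F" "y \<in> carrier ?F"
    note m = mats[OF this(1)] mats[OF this(2)]
    show "(c \<odot>\<^bsub>?F\<^esub> x) \<otimes>\<^bsub>?F\<^esub> y = c \<odot>\<^bsub>?F\<^esub> (x \<otimes>\<^bsub>?F\<^esub> y)"
      using mult_smult_assoc_mat[OF m] by simp
    show "x \<otimes>\<^bsub>?F\<^esub> (c \<odot>\<^bsub>?F\<^esub> y) = c \<odot>\<^bsub>?F\<^esub> (x \<otimes>\<^bsub>?F\<^esub> y)"
      using mult_smult_distrib[OF m] by simp
    show "adj ?F (x \<oplus>\<^bsub>?F\<^esub> y) = adj ?F x \<oplus>\<^bsub>?F\<^esub> adj ?F y"
      using mat_adjoint_add[OF m] by simp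
    show "adj ?F (x \<otimes>\<^bsub>?F\<^esub> y) = adj ?F y \<otimes>\<^bsub>?F\<^esub> adj ?F x"
      using mat_adjoint_mult[OF m] by simp
  next
    fix s :: "nat \<Rightarrow> nat \<Rightarrow> complex mat"
    assume s: "\<And>k. s k \<in> carrier ?F"
      and C: "\<And>e. e > 0 \<Longrightarrow> \<exists>N. \<forall>k\<ge>N. \<forall>l\<ge>N. cnorm ?F (s k \<ominus>\<^bsub>?F\<^esub> s l) < e"
    show "\<exists>x\<in>carrier ?F. (\<lambda>k. cnorm ?F (s k \<ominus>\<^bsub>?F\<^esub> x)) \<longlonglongrightarrow> 0"
      using mat_seq_complete[OF s C[unfolded minus[OF s s]]] minus[OF s] by auto
  next
    fix x assume "x \<in> carrier ?F"
    then show "cnorm ?F x = 0 \<longleftrightarrow> x = \<zero>\<^bsub>?F\<^esub>"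
      using norm0[of x] cnorm_zero by auto
  qed (simp_all add: mat_seq_closed mat_seq_cnorm_nonneg smult star mat_adjoint_smult)
qed

section \<open>Words in a power partial isometry\<close>

text \<open>
  A word in an element and its adjoint is a list of Booleans, where \<open>True\<close> stands for the
  element itself.
\<close>

definition letter :: "'a cstar \<Rightarrow> 'a \<Rightarrow> bool \<Rightarrow> 'a" where
  "letter A v b = (if b then v else adj A v)"

text \<open>
  The algebras have no unit in general, so the empty word has no meaningful value; zero is
  only a placeholder.
\<close>

fun word_val :: "'a cstar \<Rightarrow> 'a \<Rightarrow> bool list \<Rightarrow> 'a" where
  "word_val A v [] = \<zero>\<^bsub>A\<^esub>"
| "word_val A v [b] = letter A v b"
| "word_val A v (b # c # u) = letter A v b \<otimes>\<^bsub>A\<^esub> word_val A v (c # u)"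

text \<open>
  The action of words by left multiplication also makes sense for the empty word. Computing
  with it permits exponents zero without a unit.
\<close>

definition word_act :: "'a cstar \<Rightarrow> 'a \<Rightarrow> bool list \<Rightarrow> 'a \<Rightarrow> 'a" where
  "word_act A v u x = foldr (\<lambda>b. (\<otimes>\<^bsub>A\<^esub>) (letter A v b)) u x"

lemma word_act_Nil [simp]: "word_act A v [] x = x"
  by (simp add: word_act_def)

lemma word_act_Cons [simp]: "word_act A v (b # u) x = letter A v b \<otimes>\<^bsub>A\<^esub> word_act A v u x"
  by (simp add: word_act_def)

lemma word_act_append [simp]: "word_act A v (u @ u') x = word_act A v u (word_act A v u' x)"
  by (simp add: word_act_def)

lemma word_val_Cons: "u \<noteq> [] \<Longrightarrow> word_val A v (b # u) = letter A v b \<otimes>\<^bsub>A\<^esub> word_val A v u"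
  by (cases u) auto

locale cstar_element = cstar_algebra A for A :: "'a cstar" (structure) +
  fixes v :: 'a
  assumes element_in [simp, intro]: "v \<in> carrier A"
begin

lemma letter_in [simp, intro]: "letter A v b \<in> carrier A"
  by (simp add: letter_def)

lemma word_val_in [simp, intro]: "word_val A v u \<in> carrier A"
proof (induction u)
  case (Cons b u)
  then show ?case by (cases u) simp_all
qed simp

lemma word_act_in [simp, intro]: "x \<in> carrier A \<Longrightarrow> word_act A v u x \<in> carrier A"
  by (induction u) auto

lemma word_val_mult: "\<lbrakk>u \<noteq> []; x \<in> carrier A\<rbrakk> \<Longrightarrow> word_val A v u \<otimes> x = word_act A v u x"
  by (induction u rule: list_nonempty_induct) (simp_all add: word_val_Cons mult_assoc)

lemma word_val_append:
  "\<lbrakk>u \<noteq> []; u' \<noteq> []\<rbrakk> \<Longrightarrow> word_val A v (u @ u') = word_val A v u \<otimes> word_val A v u'"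
  by (induction u rule: list_nonempty_induct) (simp_all add: word_val_Cons mult_assoc)

lemma adj_letter: "adj A (letter A v b) = letter A v (\<not> b)"
  by (simp add: letter_def)

lemma adj_word_val: "u \<noteq> [] \<Longrightarrow> adj A (word_val A v u) = word_val A v (map Not (rev u))"
  by (induction u rule: list_nonempty_induct)
    (simp_all add: word_val_Cons adj_mult adj_letter word_val_append)

lemma pow_in [simp, intro]: "pow_Suc A v n \<in> carrier A"
  by (induction n) simp_all

lemma pow_Suc_left: "v \<otimes> pow_Suc A v n = pow_Suc A v (Suc n)"
  by (induction n) (simp_all flip: mult_assoc)

lemma word_act_True: "x \<in> carrier A \<Longrightarrow> word_act A v (replicate (Suc n) True) x = pow_Suc A v n \<otimes> x"
proof (induction n)
  case (Suc n)
  then show ?case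
    using mult_assoc[of v "pow_Suc A v n" x] pow_Suc_left[of n] by (simp add: letter_def)
qed (simp add: letter_def)

lemma word_act_False:
  "x \<in> carrier A \<Longrightarrow> word_act A v (replicate (Suc n) False) x = adj A (pow_Suc A v n) \<otimes> x"
proof (induction n)
  case (Suc n)
  then show ?case
    by (simp add: letter_def adj_mult mult_assoc)
qed (simp add: letter_def)

text \<open>
  Left multiplication is faithful: if \<open>d x = 0\<close> for all \<open>x\<close>, then \<open>d d\<^sup>* = 0\<close>, and \<open>d = 0\<close> by the
  C*-identity.
\<close>

lemma word_val_cong:
  assumes "u \<noteq> []" "u' \<noteq> []"
    and "\<And>x. x \<in> carrier A \<Longrightarrow> word_act A v u x = word_act A v u' x"
  shows "word_val A v u = word_val A v u'"
proof -
  define d where "d = word_val A v u \<ominus> word_val A v u'"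
  have d: "d \<in> carrier A" by (simp add: d_def)
  have "d \<otimes> x = \<zero>" if "x \<in> carrier A" for x
    using that assms
    by (simp add: d_def mult_minus_left word_val_mult minus_eq_zero_iff)
  from this[of "adj A d"] have "adj A d = \<zero>"
    using adj_mult_self_eq_zero[of "adj A d"] d by simp
  then have "d = \<zero>"
    using adj_adj[OF d] by simp
  then show ?thesis
    by (simp add: d_def minus_eq_zero_iff)
qed

end

text \<open>
  The words \<open>v\<^sup>a (v\<^sup>*)\<^sup>a\<^sup>+\<^sup>b v\<^sup>d\<close> with \<open>d \<le> a + b\<close> represent the elements of the free inverse monoid on
  one generator. As an operation on the basis of a finite-dimensional block, such a word is the
  partial shift by \<open>d - b\<close> positions whose target must have at least \<open>a\<close> positions before and \<open>b\<close>
  positions after it.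
\<close>

fun std_word :: "nat \<times> nat \<times> nat \<Rightarrow> bool list" where
  "std_word (a, b, d) = replicate a True @ replicate (a + b) False @ replicate d True"

text \<open>
  The parameters of the product of a letter and a word in normal form.
\<close>

fun std_step :: "bool \<Rightarrow> nat \<times> nat \<times> nat \<Rightarrow> nat \<times> nat \<times> nat" where
  "std_step True (a, 0, d) = (Suc a, 0, Suc d)"
| "std_step True (a, Suc b, d) = (Suc a, b, d)"
| "std_step False (0, b, d) = (0, Suc b, d)"
| "std_step False (Suc a, b, d) = (a, Suc b, d)"

definition std_triple :: "bool list \<Rightarrow> nat \<times> nat \<times> nat" where
  "std_triple u = foldr std_step u (0, 0, 0)"

text \<open>
  A finite set, of size cubic in \<open>n\<close>, that contains the parameters of all nonempty words of length
  at most \<open>n\<close>. The parameters with \<open>a = b = 0\<close> would belong to the unit.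
\<close>

definition triples :: "nat \<Rightarrow> (nat \<times> nat \<times> nat) set" where
  "triples n = {(a, b, d). 1 \<le> a + b \<and> a + b \<le> n \<and> d \<le> a + b}"

lemma finite_triples [simp]: "finite (triples n)"
  and card_triples: "card (triples n) \<le> (n + 1) ^ 3"
proof -
  have sub: "triples n \<subseteq> {..n} \<times> {..n} \<times> {..n}"
    by (auto simp: triples_def)
  then show "finite (triples n)"
    by (rule finite_subset) simp
  show "card (triples n) \<le> (n + 1) ^ 3"
    using card_mono[OF _ sub] by (simp add: power3_eq_cube algebra_simps)
qed

lemma std_word_nonempty: "t \<in> triples n \<Longrightarrow> std_word t \<noteq> []"
  by (auto simp: triples_def)

lemma std_triple_in:
  assumes "u \<noteq> []" "length u \<le> n"
  shows "std_triple u \<in> triples n"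
proof -
  have *: "case std_triple u of (a, b, d) \<Rightarrow> d \<le> a + b \<and> a + b \<le> length u \<and> (u \<noteq> [] \<longrightarrow> 1 \<le> a + b)" for u
  proof (induction u)
    case (Cons c u)
    obtain a b d where "std_triple u = (a, b, d)" by (cases "std_triple u") auto
    with Cons show ?case
      by (cases c; cases a; cases b) (auto simp: std_triple_def)
  qed (simp add: std_triple_def)
  show ?thesis
    using *[of u] assms by (auto simp: triples_def split: prod.splits)
qed

text \<open>
  For \<open>z = q p - p q p\<close> the hypothesis gives \<open>z\<^sup>* z = 0\<close>. Hence \<open>q p = p q p\<close>, which is self-adjoint.
\<close>

lemma (in cstar_algebra) projections_commute:
  assumes p: "p \<in> carrier A" "adj A p = p" "p \<otimes> p = p"
    and q: "q \<in> carrier A" "adj A q = q" "q \<otimes> q = q"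
    and pq: "p \<otimes> q \<otimes> p \<otimes> q = p \<otimes> q"
  shows "p \<otimes> q = q \<otimes> p"
proof -
  have pp: "p \<otimes> (p \<otimes> x) = p \<otimes> x" and qq: "q \<otimes> (q \<otimes> x) = q \<otimes> x"
    and pqpq: "p \<otimes> (q \<otimes> (p \<otimes> (q \<otimes> x))) = p \<otimes> (q \<otimes> x)" if "x \<in> carrier A" for x
    using p q that pq mult_assoc[of p p x] mult_assoc[of q q x]
      mult_assoc[of "p \<otimes> q" "p \<otimes> q" x] by (simp_all add: mult_assoc)
  define z where "z = q \<otimes> p \<ominus> p \<otimes> (q \<otimes> p)"
  have z: "z \<in> carrier A"
    using p q by (simp add: z_def)
  have "adj A z = p \<otimes> q \<ominus> p \<otimes> (q \<otimes> p)"
    using p q by (simp add: z_def minus_eq_smult adj_add adj_smult adj_mult mult_assoc)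
  then have "adj A z \<otimes> z = \<zero>"
    using p q
    by (simp add: z_def mult_minus_left mult_minus_right mult_assoc pp qq pqpq
        minus_eq_zero_iff[THEN iffD2])
  then have "z = \<zero>"
    by (rule adj_mult_self_eq_zero[OF z])
  then have qp: "q \<otimes> p = p \<otimes> (q \<otimes> p)"
    using p q by (simp add: z_def minus_eq_zero_iff)
  then have "adj A (q \<otimes> p) = adj A (p \<otimes> (q \<otimes> p))" by simp
  then have "p \<otimes> q = p \<otimes> (q \<otimes> p)"
    using p q by (simp add: adj_mult mult_assoc)
  with qp show ?thesis by simp
qed

locale ppi = cstar_algebra A for A :: "'a cstar" (structure) +
  fixes v :: 'a
  assumes ppi: "power_partial_isometry A v"

sublocale ppi \<subseteq> cstar_element
  using ppi by unfold_locales
    (metis partial_isometry_def pow_Suc.simps(1) power_partial_isometry_def)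

context ppi
begin

lemma pow_partial_isometry:
  "pow_Suc A v n \<otimes> (adj A (pow_Suc A v n) \<otimes> pow_Suc A v n) = pow_Suc A v n"
  using ppi pow_in[of n]
  by (simp add: power_partial_isometry_def partial_isometry_def flip: mult_assoc)

text \<open>
  With \<open>f = v\<^sup>* v\<close> and \<open>e = v\<^sup>m (v\<^sup>*)\<^sup>m\<close>, the relation \<open>f e f e = f e\<close> required by
  \<open>projections_commute\<close> is the partial isometry relation of \<open>v\<^sup>m\<^sup>+\<^sup>1\<close>, multiplied by \<open>v\<^sup>*\<close> from the left
  and by \<open>(v\<^sup>*)\<^sup>m\<close> from the right. Here \<open>m = n + 1\<close>.
\<close>

lemma source_range_commute:
  defines "f \<equiv> adj A v \<otimes> v" and "e \<equiv> \<lambda>n. pow_Suc A v n \<otimes> adj A (pow_Suc A v n)"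
  shows "f \<otimes> e n = e n \<otimes> f"
proof (rule projections_commute)
  let ?p = "pow_Suc A v n"
  have v: "v \<otimes> (adj A v \<otimes> v) = v"
    using pow_partial_isometry[of 0] by simp
  show "f \<in> carrier A" "e n \<in> carrier A" "adj A f = f" "adj A (e n) = e n" "f \<otimes> f = f"
    by (simp_all add: f_def e_def adj_mult mult_assoc v)
  have "e n \<otimes> e n = (?p \<otimes> (adj A ?p \<otimes> ?p)) \<otimes> adj A ?p"
    by (simp add: e_def mult_assoc)
  then show "e n \<otimes> e n = e n"
    by (simp only: pow_partial_isometry) (simp add: e_def)
  let ?q = "v \<otimes> ?p"
  have "?q \<otimes> (adj A ?q \<otimes> ?q) = ?q"
    unfolding pow_Suc_left by (rule pow_partial_isometry)
  then have "adj A v \<otimes> (?q \<otimes> (adj A ?q \<otimes> ?q)) \<otimes> adj A ?p = adj A v \<otimes> ?q \<otimes> adj A ?p"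
    by simp
  then show "f \<otimes> e n \<otimes> f \<otimes> e n = f \<otimes> e n"
    by (simp add: f_def e_def adj_mult mult_assoc)
qed

text \<open>
  In the notation of \<open>source_range_commute\<close>, \<open>v e = v f e = v e f\<close>.
\<close>

lemma word_act_True_range:
  assumes z: "z \<in> carrier A"
  shows "word_act A v (True # replicate n True @ replicate n False) z =
    word_act A v (replicate (Suc n) True @ replicate (Suc n) False @ [True]) z"
proof (cases n)
  case 0
  then show ?thesis
    using pow_partial_isometry[of 0] mult_assoc[of v "adj A v \<otimes> v" z] z
    by (simp add: letter_def mult_assoc)
next
  case (Suc k)
  let ?p = "pow_Suc A v k"
  let ?f = "adj A v \<otimes> v"
  have "v = v \<otimes> ?f"
    using pow_partial_isometry[of 0] by simp
  then have "v \<otimes> (?p \<otimes> (adj A ?p \<otimes> z)) = v \<otimes> (?f \<otimes> (?p \<otimes> adj A ?p) \<otimes> z)"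
    using z by (metis mult_assoc pow_in adj_closed element_in mult_closed)
  also have "\<dots> = v \<otimes> (?p \<otimes> adj A ?p \<otimes> ?f \<otimes> z)"
    by (simp add: source_range_commute)
  also have "\<dots> = pow_Suc A v (Suc k) \<otimes> (adj A (pow_Suc A v (Suc k)) \<otimes> (v \<otimes> z))"
    unfolding pow_Suc_left[symmetric] using z
    by (simp add: adj_mult mult_assoc pow_Suc_left[symmetric])
  finally show ?thesis
    using z Suc word_act_True[of _ k] word_act_False[of _ k] word_act_True[of _ "Suc k"]
      word_act_False[of _ "Suc k"]
    by (simp add: letter_def del: replicate.simps)
qed

text \<open>
  In the notation of \<open>source_range_commute\<close>, \<open>f e v\<^sup>* = e f v\<^sup>* = e v\<^sup>*\<close>.
\<close>

lemma word_act_False_range: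
  assumes z: "z \<in> carrier A"
  shows "word_act A v (False # replicate (Suc n) True @ replicate (Suc n) False) z =
    word_act A v (replicate n True @ replicate (Suc n) False) z"
proof (cases n)
  case 0
  have "adj A (v \<otimes> (adj A v \<otimes> v)) = adj A v"
    using pow_partial_isometry[of 0] by simp
  then have "adj A v \<otimes> (v \<otimes> adj A v) \<otimes> z = adj A v \<otimes> z"
    by (simp add: adj_mult mult_assoc)
  then show ?thesis
    using z 0 by (simp add: letter_def mult_assoc)
next
  case (Suc k)
  let ?p = "pow_Suc A v k"
  let ?f = "adj A v \<otimes> v"
  have fv: "?f \<otimes> adj A v = adj A v"
    using arg_cong[OF pow_partial_isometry[of 0], of "adj A"] by (simp add: adj_mult mult_assoc)
  have "adj A v \<otimes> (v \<otimes> (?p \<otimes> (adj A ?p \<otimes> (adj A v \<otimes> z)))) =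
      (?f \<otimes> (?p \<otimes> adj A ?p)) \<otimes> (adj A v \<otimes> z)"
    using z by (simp add: mult_assoc)
  also have "\<dots> = (?p \<otimes> adj A ?p) \<otimes> ((?f \<otimes> adj A v) \<otimes> z)"
    unfolding source_range_commute using z by (simp add: mult_assoc)
  also have "\<dots> = ?p \<otimes> (adj A ?p \<otimes> (adj A v \<otimes> z))"
    unfolding fv using z by (simp add: mult_assoc)
  finally have *: "adj A v \<otimes> (v \<otimes> (?p \<otimes> (adj A ?p \<otimes> (adj A v \<otimes> z)))) =
    ?p \<otimes> (adj A ?p \<otimes> (adj A v \<otimes> z))" .
  have F: "word_act A v (replicate (Suc n) False) z =
      word_act A v (replicate n False) (adj A v \<otimes> z)"
    unfolding replicate_Suc replicate_append_same[symmetric] by (simp add: letter_def)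
  show ?thesis
    using z * Suc word_act_True[of _ k] word_act_False[of "adj A v \<otimes> z" k] F
    by (simp add: letter_def replicate_Suc[of "Suc k" True] del: replicate.simps)
qed

lemma word_act_std_step:
  assumes "x \<in> carrier A"
  shows "word_act A v (c # std_word t) x = word_act A v (std_word (std_step c t)) x"
proof (cases "(c, t)" rule: std_step.cases)
  case (1 a d)
  then show ?thesis
    using word_act_True_range[of "word_act A v (replicate d True) x" a] assms by simp
next
  case (4 a b d)
  then show ?thesis
    using word_act_False_range[of "word_act A v (replicate b False @ replicate d True) x" a] assms
    by (simp add: replicate_add)
qed simp_all

text \<open>
  Prepending the letters of a word one after the other, each time returning to normal form.
  The resulting parameters are the same for all power partial isometries.
\<close>

lemma word_act_std:
  "x \<in> carrier A \<Longrightarrow> word_act A v u x = word_act A v (std_word (std_triple u)) x"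
proof (induction u)
  case (Cons c u)
  then show ?case
    using word_act_std_step[of x c "std_triple u"] by (simp add: std_triple_def)
qed (simp add: std_triple_def)

lemma word_val_std: "u \<noteq> [] \<Longrightarrow> word_val A v u = word_val A v (std_word (std_triple u))"
  using std_word_nonempty[OF std_triple_in[of u "length u"]]
  by (intro word_val_cong word_act_std) auto

text \<open>
  The norm of the projection \<open>v\<^sup>* v\<close> equals its own square.
\<close>

lemma cnorm_element_le_1: "cnorm A v \<le> 1"
proof -
  let ?f = "adj A v \<otimes> v"
  have "?f \<otimes> ?f = ?f"
    using pow_partial_isometry[of 0] by (simp add: mult_assoc)
  then have "(cnorm A ?f)\<^sup>2 = cnorm A ?f"
    using cstar_identity[of ?f] by (simp add: adj_mult)
  then have "cnorm A ?f \<le> 1"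
    by (auto simp: power2_eq_square)
  then have "(cnorm A v)\<^sup>2 \<le> 1"
    by (simp add: cstar_identity)
  then show ?thesis
    using power2_le_imp_le[of "cnorm A v" 1] by simp
qed

lemma cnorm_letter_le_1: "cnorm A (letter A v b) \<le> 1"
  using cnorm_element_le_1 by (simp add: letter_def)

lemma cnorm_word_act_le: "x \<in> carrier A \<Longrightarrow> cnorm A (word_act A v u x) \<le> cnorm A x"
proof (induction u)
  case (Cons b u)
  have "cnorm A (word_act A v (b # u) x) \<le> cnorm A (letter A v b) * cnorm A (word_act A v u x)"
    using Cons.prems by (simp add: cnorm_mult)
  also have "\<dots> \<le> 1 * cnorm A (word_act A v u x)"
    using Cons.prems cnorm_letter_le_1 by (intro mult_right_mono cnorm_nonneg) auto
  finally show ?case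
    using Cons by simp
qed simp

lemma cnorm_word_val_le_1: "u \<noteq> [] \<Longrightarrow> cnorm A (word_val A v u) \<le> 1"
proof (induction u rule: list_nonempty_induct)
  case (cons b u)
  have "cnorm A (word_val A v (b # u)) \<le> cnorm A (letter A v b) * cnorm A (word_val A v u)"
    using cons by (simp add: word_val_Cons cnorm_mult)
  also have "\<dots> \<le> 1 * 1"
    using cons cnorm_letter_le_1 by (intro mult_mono cnorm_nonneg) auto
  finally show ?case by simp
qed (simp add: cnorm_letter_le_1)

end

section \<open>Polynomial values in two algebras\<close>

text \<open>
  The elements \<open>x\<close> and \<open>y\<close> are the values at \<open>v\<close> and at \<open>w\<close> of one *-polynomial of degree at most
  \<open>n\<close> without constant term. This relation is the graph of the correspondence \<open>p(v) \<mapsto> p(w)\<close>; a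
  norm estimate will show it to be a function. It is symmetric in the two algebras.
\<close>

inductive same_poly ::
  "'a cstar \<Rightarrow> 'a \<Rightarrow> 'b cstar \<Rightarrow> 'b \<Rightarrow> nat \<Rightarrow> 'a \<Rightarrow> 'b \<Rightarrow> bool"
  for A v B w n where
  zero: "same_poly A v B w n \<zero>\<^bsub>A\<^esub> \<zero>\<^bsub>B\<^esub>"
| step: "\<lbrakk>same_poly A v B w n x y; u \<noteq> []; length u \<le> n\<rbrakk> \<Longrightarrow>
    same_poly A v B w n (c \<odot>\<^bsub>A\<^esub> word_val A v u \<oplus>\<^bsub>A\<^esub> x) (c \<odot>\<^bsub>B\<^esub> word_val B w u \<oplus>\<^bsub>B\<^esub> y)"

lemma same_poly_sym: "same_poly A v B w n x y \<Longrightarrow> same_poly B w A v n y x"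
  by (induction rule: same_poly.induct) (auto intro: same_poly.intros)

lemma same_poly_mono: "same_poly A v B w n x y \<Longrightarrow> n \<le> m \<Longrightarrow> same_poly A v B w m x y"
  by (induction rule: same_poly.induct) (auto intro: same_poly.intros)

locale cstar_element_pair = A: cstar_element A v + B: cstar_element B w
  for A :: "'a cstar" and v and B :: "'b cstar" and w
begin

abbreviation sp :: "nat \<Rightarrow> 'a \<Rightarrow> 'b \<Rightarrow> bool" where
  "sp \<equiv> same_poly A v B w"

lemma same_poly_in: "sp n x y \<Longrightarrow> x \<in> carrier A \<and> y \<in> carrier B"
  by (induction rule: same_poly.induct) auto

lemma same_poly_word:
  "\<lbrakk>u \<noteq> []; length u \<le> n\<rbrakk> \<Longrightarrow> sp n (word_val A v u) (word_val B w u)"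
  using step[OF zero, of u n A v B w 1] by simp

lemma same_poly_add:
  assumes "sp n x y" "sp n x' y'"
  shows "sp n (x \<oplus>\<^bsub>A\<^esub> x') (y \<oplus>\<^bsub>B\<^esub> y')"
  using assms(1)
proof (induction rule: same_poly.induct)
  case zero
  then show ?case using assms(2) same_poly_in[OF assms(2)] by simp
next
  case (step x y u c)
  then show ?case
    using same_poly.step[OF step.IH step.hyps(2,3), of c] same_poly_in[OF step.hyps(1)]
      same_poly_in[OF assms(2)] by (simp add: A.a_assoc B.a_assoc)
qed

lemma same_poly_smult: "sp n x y \<Longrightarrow> sp n (c \<odot>\<^bsub>A\<^esub> x) (c \<odot>\<^bsub>B\<^esub> y)"
proof (induction rule: same_poly.induct)
  case (step x y u d)
  then show ?case
    using same_poly.step[OF step.IH step.hyps(2,3), of "c * d"] same_poly_in[OF step.hyps(1)]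
    by (simp add: A.smult_add_right B.smult_add_right A.smult_smult B.smult_smult)
qed (simp add: same_poly.zero)

lemma same_poly_minus:
  assumes "sp n x y" "sp n x' y'"
  shows "sp n (x \<ominus>\<^bsub>A\<^esub> x') (y \<ominus>\<^bsub>B\<^esub> y')"
  using same_poly_add[OF assms(1) same_poly_smult[OF assms(2), of "-1"]]
    same_poly_in[OF assms(1)] same_poly_in[OF assms(2)]
  by (simp add: A.minus_eq_smult B.minus_eq_smult)

lemma same_poly_word_mult:
  assumes "sp m x y" "u \<noteq> []" "length u \<le> n"
  shows "sp (n + m) (word_val A v u \<otimes>\<^bsub>A\<^esub> x) (word_val B w u \<otimes>\<^bsub>B\<^esub> y)"
  using assms(1)
proof (induction rule: same_poly.induct)
  case (step x y u' c)
  have "sp (n + m) (word_val A v (u @ u')) (word_val B w (u @ u'))"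
    using step assms(2,3) by (intro same_poly_word) auto
  from same_poly_add[OF same_poly_smult[OF this, of c] step.IH] show ?case
    using same_poly_in[OF step.hyps(1)] step.hyps(2) assms(2)
    by (simp add: A.word_val_append B.word_val_append A.distrib_left B.distrib_left
        A.smult_mult_right B.smult_mult_right)
qed (simp add: same_poly.zero)

lemma same_poly_mult:
  assumes "sp n x y" "sp m x' y'"
  shows "sp (n + m) (x \<otimes>\<^bsub>A\<^esub> x') (y \<otimes>\<^bsub>B\<^esub> y')"
  using assms(1)
proof (induction rule: same_poly.induct)
  case zero
  then show ?case using same_poly_in[OF assms(2)] by (simp add: same_poly.zero)
next
  case (step x y u c)
  from same_poly_add[OF same_poly_smult[OF same_poly_word_mult[OF assms(2) step.hyps(2,3)], of c] step.IH]
  show ?case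
    using same_poly_in[OF step.hyps(1)] same_poly_in[OF assms(2)]
    by (simp add: A.distrib_right B.distrib_right A.smult_mult_left B.smult_mult_left)
qed

lemma same_poly_adj: "sp n x y \<Longrightarrow> sp n (adj A x) (adj B y)"
proof (induction rule: same_poly.induct)
  case (step x y u c)
  have "sp n (adj A (word_val A v u)) (adj B (word_val B w u))"
    using step.hyps(2,3) by (simp add: A.adj_word_val B.adj_word_val same_poly_word)
  from same_poly_add[OF same_poly_smult[OF this, of "cnj c"] step.IH] show ?case
    using same_poly_in[OF step.hyps(1)]
    by (simp add: A.adj_add B.adj_add A.adj_smult B.adj_smult)
qed (simp add: same_poly.zero)

lemma same_poly_letter: "n \<ge> 1 \<Longrightarrow> sp n (letter A v b) (letter B w b)"
  using same_poly_word[of "[b]" n] by simp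

lemma same_poly_word_act:
  "sp m x y \<Longrightarrow> sp (length u + m) (word_act A v u x) (word_act B w u y)"
proof (induction u)
  case (Cons b u)
  then show ?case
    using same_poly_mult[OF same_poly_letter[of 1 b] Cons.IH] by simp
qed simp

end

context cstar_algebra
begin

abbreviation sq :: "'a \<Rightarrow> 'a" where "sq x \<equiv> x \<otimes> x"

text \<open>
  The C*-identity says that squaring a self-adjoint element squares its norm.
\<close>

lemma cnorm_iterated_square:
  assumes "x \<in> carrier A" "adj A x = x"
  shows "cnorm A ((sq ^^ k) x) = cnorm A x ^ (2 ^ k)"
proof -
  have "(sq ^^ k) x \<in> carrier A \<and> adj A ((sq ^^ k) x) = (sq ^^ k) x
      \<and> cnorm A ((sq ^^ k) x) = cnorm A x ^ (2 ^ k)"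
  proof (induction k)
    case (Suc k)
    then show ?case
      using cstar_identity[of "(sq ^^ k) x"] by (simp add: adj_mult power_mult[symmetric] mult.commute)
  qed (simp add: assms)
  then show ?thesis by blast
qed

lemma finsum_scaled_update:
  assumes "finite T" "t \<in> T" "f \<in> T \<rightarrow> carrier A"
  shows "(\<Oplus>s\<in>T. (c(t := a + c t)) s \<odot>\<^bsub>A\<^esub> f s) = a \<odot>\<^bsub>A\<^esub> f t \<oplus> (\<Oplus>s\<in>T. c s \<odot>\<^bsub>A\<^esub> f s)"
proof -
  let ?S = "T - {t}"
  have f: "f s \<in> carrier A" if "s \<in> T" for s
    using assms(3) that by auto
  have T: "T = insert t ?S" "finite ?S" "t \<notin> ?S"
    using assms by auto
  have split: "(\<Oplus>s\<in>T. g s \<odot>\<^bsub>A\<^esub> f s) = g t \<odot>\<^bsub>A\<^esub> f t \<oplus> (\<Oplus>s\<in>?S. g s \<odot>\<^bsub>A\<^esub> f s)" for g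
    using T(2,3) f assms(2) by (subst T(1), subst finsum_insert) (auto intro!: f)
  have same: "(\<Oplus>s\<in>?S. (c(t := a + c t)) s \<odot>\<^bsub>A\<^esub> f s) = (\<Oplus>s\<in>?S. c s \<odot>\<^bsub>A\<^esub> f s)"
    using f by (intro finsum_cong') auto
  have "(\<Oplus>s\<in>?S. c s \<odot>\<^bsub>A\<^esub> f s) \<in> carrier A"
    using f by (intro finsum_closed) auto
  then show ?thesis
    using f[OF assms(2)] unfolding split same by (simp add: smult_add_left a_assoc)
qed

lemma cnorm_finsum_le:
  assumes "finite T" "f \<in> T \<rightarrow> carrier A" "\<And>t. t \<in> T \<Longrightarrow> cnorm A (f t) \<le> 1"
  shows "cnorm A (\<Oplus>t\<in>T. c t \<odot>\<^bsub>A\<^esub> f t) \<le> (\<Sum>t\<in>T. cmod (c t))"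
  using assms
proof (induction T)
  case (insert t T)
  have f: "f t \<in> carrier A" "f \<in> T \<rightarrow> carrier A"
    using insert.prems(1) by auto
  then have in_A: "(\<Oplus>t\<in>T. c t \<odot>\<^bsub>A\<^esub> f t) \<in> carrier A"
    by (intro finsum_closed) auto
  have "(\<Oplus>t\<in>insert t T. c t \<odot>\<^bsub>A\<^esub> f t) = c t \<odot>\<^bsub>A\<^esub> f t \<oplus> (\<Oplus>t\<in>T. c t \<odot>\<^bsub>A\<^esub> f t)"
    using f insert.hyps by (intro finsum_insert) auto
  then have "cnorm A (\<Oplus>t\<in>insert t T. c t \<odot>\<^bsub>A\<^esub> f t)
      \<le> cmod (c t) * cnorm A (f t) + cnorm A (\<Oplus>t\<in>T. c t \<odot>\<^bsub>A\<^esub> f t)"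
    using cnorm_triangle[of "c t \<odot>\<^bsub>A\<^esub> f t" "\<Oplus>t\<in>T. c t \<odot>\<^bsub>A\<^esub> f t"] f in_A
    by (simp add: cnorm_smult)
  also have "\<dots> \<le> cmod (c t) + (\<Sum>t\<in>T. cmod (c t))"
    using insert f by (intro add_mono mult_left_le) auto
  finally show ?case
    using insert.hyps by simp
qed simp

end

text \<open>
  A factor that is polynomial in \<open>2\<^sup>k\<close> cannot compensate for the exponential decay of
  \<open>(X / Y)\<close> raised to the power \<open>2\<^sup>k\<close>.
\<close>

lemma le_of_poly_growth:
  fixes X Y K m :: real
  assumes nonneg: "0 \<le> X" "0 \<le> Y" "0 \<le> m"
    and growth: "\<And>k. Y ^ (2 ^ k) \<le> K * (2 ^ k * m + 1) ^ 3 * X ^ (2 ^ k)"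
  shows "Y \<le> X"
proof (rule ccontr)
  assume "\<not> Y \<le> X"
  then have Y: "0 < Y" "X < Y" using nonneg by auto
  \<comment> \<open>The cube root distributes one decaying factor to each of the three linear factors.\<close>
  define q where "q = root 3 (X / Y)"
  have q: "0 \<le> q" "q < 1" "q ^ 3 = X / Y"
    using Y nonneg by (simp_all add: q_def)
  have "(\<lambda>j. m * (of_nat j * q ^ j) + q ^ j) \<longlonglongrightarrow> m * 0 + 0"
    using q powser_times_n_limit_0[of q] LIMSEQ_realpow_zero[of q]
    by (intro tendsto_add tendsto_mult tendsto_const) simp_all
  then have "(\<lambda>j. K * (m * (of_nat j * q ^ j) + q ^ j) ^ 3) \<longlonglongrightarrow> K * (m * 0 + 0) ^ 3"
    by (intro tendsto_mult[OF tendsto_const tendsto_power])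
  moreover have "K * (m * (of_nat j * q ^ j) + q ^ j) ^ 3 = K * (real j * m + 1) ^ 3 * (X / Y) ^ j" for j
  proof -
    have "m * (of_nat j * q ^ j) + q ^ j = (real j * m + 1) * q ^ j"
      by (simp add: algebra_simps)
    moreover have "(q ^ j) ^ 3 = (X / Y) ^ j"
      unfolding q(3)[symmetric] by (simp add: mult.commute flip: power_mult)
    ultimately show ?thesis
      by (simp only: power_mult_distrib mult.assoc)
  qed
  ultimately have "(\<lambda>j. K * (real j * m + 1) ^ 3 * (X / Y) ^ j) \<longlonglongrightarrow> 0"
    by (simp only: mult_zero_right add_0 power_zero_numeral)
  from LIMSEQ_subseq_LIMSEQ[OF this, of "\<lambda>k. 2 ^ k"]
  have "(\<lambda>k. K * (real (2 ^ k) * m + 1) ^ 3 * (X / Y) ^ (2 ^ k)) \<longlonglongrightarrow> 0"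
    by (simp add: strict_mono_def o_def)
  moreover have "1 \<le> K * (real (2 ^ k) * m + 1) ^ 3 * (X / Y) ^ (2 ^ k)" for k
    using growth[of k] Y by (simp add: power_divide field_simps)
  ultimately have "1 \<le> (0 :: real)"
    by (intro LIMSEQ_le_const) auto
  then show False by simp
qed

context cstar_element_pair
begin

lemma same_poly_iterated_square:
  "sp n x y \<Longrightarrow> sp (2 ^ k * n) ((A.sq ^^ k) x) ((B.sq ^^ k) y)"
proof (induction k)
  case (Suc k)
  then show ?case
    using same_poly_mult[OF Suc.IH Suc.IH] by (simp add: mult_2 distrib_right)
qed simp

text \<open>
  A bound with a factor polynomial in the degree improves itself to the bound with factor one.
  Apply it to the \<open>2\<^sup>k\<close>-th power of \<open>x\<^sup>* x\<close>, whose degree is \<open>2\<^sup>k\<close> times as large and whose norm is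
  the \<open>2\<^sup>k\<close>-th power of the norm of \<open>x\<^sup>* x\<close>.
\<close>

lemma same_poly_contractive:
  assumes bound: "\<And>n x y. sp n x y \<Longrightarrow> cnorm B y \<le> K * (real n + 1) ^ 3 * cnorm A x"
    and xy: "sp n x y"
  shows "cnorm B y \<le> cnorm A x"
proof -
  note in_carrier = same_poly_in[OF xy]
  let ?x = "adj A x \<otimes>\<^bsub>A\<^esub> x" and ?y = "adj B y \<otimes>\<^bsub>B\<^esub> y"
  have sp: "sp (2 * n) ?x ?y"
    using same_poly_mult[OF same_poly_adj[OF xy] xy] by (simp add: mult_2)
  have growth: "cnorm B ?y ^ (2 ^ k) \<le> K * (2 ^ k * real (2 * n) + 1) ^ 3 * cnorm A ?x ^ (2 ^ k)" for k
    using bound[OF same_poly_iterated_square[OF sp, of k]] in_carrier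
    by (simp add: A.cnorm_iterated_square B.cnorm_iterated_square A.adj_mult B.adj_mult)
  have "cnorm B ?y \<le> cnorm A ?x"
    by (rule le_of_poly_growth[OF _ _ _ growth])
      (use in_carrier in \<open>simp_all add: A.cnorm_nonneg B.cnorm_nonneg\<close>)
  then have "(cnorm B y)\<^sup>2 \<le> (cnorm A x)\<^sup>2"
    using in_carrier by (simp add: A.cstar_identity B.cstar_identity)
  then show ?thesis
    by (rule power2_le_imp_le) (use in_carrier A.cnorm_nonneg in blast)
qed

end

locale ppi_pair = A: ppi A v + B: ppi B w for A :: "'a cstar" and v and B :: "'b cstar" and w

sublocale ppi_pair \<subseteq> cstar_element_pair ..

context ppi_pair
begin

text \<open>
  The reduction of words to normal form does not depend on the algebra, so both values are
  linear combinations of normal forms with the same coefficients.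
\<close>

lemma same_poly_std:
  assumes "sp n x y"
  shows "\<exists>c. x = (\<Oplus>\<^bsub>A\<^esub>t\<in>triples n. c t \<odot>\<^bsub>A\<^esub> word_val A v (std_word t)) \<and>
    y = (\<Oplus>\<^bsub>B\<^esub>t\<in>triples n. c t \<odot>\<^bsub>B\<^esub> word_val B w (std_word t))"
  using assms
proof (induction rule: same_poly.induct)
  case zero
  have "(\<Oplus>\<^bsub>A\<^esub>t\<in>triples n. 0 \<odot>\<^bsub>A\<^esub> word_val A v (std_word t)) = \<zero>\<^bsub>A\<^esub>"
    "(\<Oplus>\<^bsub>B\<^esub>t\<in>triples n. 0 \<odot>\<^bsub>B\<^esub> word_val B w (std_word t)) = \<zero>\<^bsub>B\<^esub>"
    by simp_all
  then show ?case
    by (intro exI[of _ "\<lambda>_. 0"]) simp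
next
  case (step x y u a)
  from step.IH obtain c where c: "x = (\<Oplus>\<^bsub>A\<^esub>t\<in>triples n. c t \<odot>\<^bsub>A\<^esub> word_val A v (std_word t))"
    "y = (\<Oplus>\<^bsub>B\<^esub>t\<in>triples n. c t \<odot>\<^bsub>B\<^esub> word_val B w (std_word t))"
    by blast
  let ?t = "std_triple u"
  have t: "?t \<in> triples n"
    using step.hyps(2,3) by (rule std_triple_in)
  let ?f = "\<lambda>t. word_val A v (std_word t)" and ?g = "\<lambda>t. word_val B w (std_word t)"
  have "a \<odot>\<^bsub>A\<^esub> word_val A v u \<oplus>\<^bsub>A\<^esub> x = (\<Oplus>\<^bsub>A\<^esub>t\<in>triples n. (c(?t := a + c ?t)) t \<odot>\<^bsub>A\<^esub> ?f t)"
    unfolding c(1) A.word_val_std[OF step.hyps(2)]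
    by (rule A.finsum_scaled_update[where f = ?f, OF finite_triples t, symmetric]) simp
  moreover have "a \<odot>\<^bsub>B\<^esub> word_val B w u \<oplus>\<^bsub>B\<^esub> y = (\<Oplus>\<^bsub>B\<^esub>t\<in>triples n. (c(?t := a + c ?t)) t \<odot>\<^bsub>B\<^esub> ?g t)"
    unfolding c(2) B.word_val_std[OF step.hyps(2)]
    by (rule B.finsum_scaled_update[where f = ?g, OF finite_triples t, symmetric]) simp
  ultimately show ?case
    by (intro exI[of _ "c(?t := a + c ?t)"]) (rule conjI)
qed

end

section \<open>Extension to the generated C*-algebras\<close>

context cstar_element_pair
begin

text \<open>
  The closure of the graph of \<open>p(v) \<mapsto> p(w)\<close> in the product of the two algebras.
\<close>

definition same_limit :: "'a \<Rightarrow> 'b \<Rightarrow> bool" where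
  "same_limit x y \<longleftrightarrow> x \<in> carrier A \<and> y \<in> carrier B \<and>
    (\<exists>s t. (\<forall>k. \<exists>n. sp n (s k) (t k)) \<and> A.tends s x \<and> B.tends t y)"

lemma same_limitI:
  assumes "\<And>k. \<exists>n. sp n (s k) (t k)" "A.tends s x" "B.tends t y" "x \<in> carrier A" "y \<in> carrier B"
  shows "same_limit x y"
  using assms unfolding same_limit_def by blast

lemma same_limitE:
  assumes "same_limit x y"
  obtains s t where "\<And>k. \<exists>n. sp n (s k) (t k)" "A.tends s x" "B.tends t y"
    "x \<in> carrier A" "y \<in> carrier B" "\<And>k. s k \<in> carrier A" "\<And>k. t k \<in> carrier B"
  using assms same_poly_in unfolding same_limit_def by metis

lemma same_limit_in: "same_limit x y \<Longrightarrow> x \<in> carrier A \<and> y \<in> carrier B"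
  by (simp add: same_limit_def)

lemma same_limit_poly:
  assumes "sp n x y" shows "same_limit x y"
  using assms same_poly_in[OF assms]
  by (intro same_limitI[of "\<lambda>_. x" "\<lambda>_. y"] A.tends_const B.tends_const) auto

lemma same_limit_add:
  assumes "same_limit x y" "same_limit x' y'"
  shows "same_limit (x \<oplus>\<^bsub>A\<^esub> x') (y \<oplus>\<^bsub>B\<^esub> y')"
proof -
  obtain s t where s: "\<And>k. \<exists>n. sp n (s k) (t k)" "A.tends s x" "B.tends t y"
    "x \<in> carrier A" "y \<in> carrier B" "\<And>k. s k \<in> carrier A" "\<And>k. t k \<in> carrier B"
    using same_limitE[OF assms(1)] by metis
  obtain s' t' where s': "\<And>k. \<exists>n. sp n (s' k) (t' k)" "A.tends s' x'" "B.tends t' y'"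
    "x' \<in> carrier A" "y' \<in> carrier B" "\<And>k. s' k \<in> carrier A" "\<And>k. t' k \<in> carrier B"
    using same_limitE[OF assms(2)] by metis
  show ?thesis
  proof (rule same_limitI[where s = "\<lambda>k. s k \<oplus>\<^bsub>A\<^esub> s' k" and t = "\<lambda>k. t k \<oplus>\<^bsub>B\<^esub> t' k"])
    fix k
    obtain n n' where "sp n (s k) (t k)" "sp n' (s' k) (t' k)"
      using s(1)[of k] s'(1)[of k] by blast
    then have "sp (max n n') (s k) (t k)" "sp (max n n') (s' k) (t' k)"
      by (auto intro: same_poly_mono)
    then show "\<exists>n. sp n (s k \<oplus>\<^bsub>A\<^esub> s' k) (t k \<oplus>\<^bsub>B\<^esub> t' k)"
      using same_poly_add by blast
  qed (use s s' in \<open>simp_all add: A.tends_add B.tends_add\<close>)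
qed

lemma same_limit_mult:
  assumes "same_limit x y" "same_limit x' y'"
  shows "same_limit (x \<otimes>\<^bsub>A\<^esub> x') (y \<otimes>\<^bsub>B\<^esub> y')"
proof -
  obtain s t where s: "\<And>k. \<exists>n. sp n (s k) (t k)" "A.tends s x" "B.tends t y"
    "x \<in> carrier A" "y \<in> carrier B" "\<And>k. s k \<in> carrier A" "\<And>k. t k \<in> carrier B"
    using same_limitE[OF assms(1)] by metis
  obtain s' t' where s': "\<And>k. \<exists>n. sp n (s' k) (t' k)" "A.tends s' x'" "B.tends t' y'"
    "x' \<in> carrier A" "y' \<in> carrier B" "\<And>k. s' k \<in> carrier A" "\<And>k. t' k \<in> carrier B"
    using same_limitE[OF assms(2)] by metis
  show ?thesis
  proof (rule same_limitI[where s = "\<lambda>k. s k \<otimes>\<^bsub>A\<^esub> s' k" and t = "\<lambda>k. t k \<otimes>\<^bsub>B\<^esub> t' k"])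
    show "\<exists>n. sp n (s k \<otimes>\<^bsub>A\<^esub> s' k) (t k \<otimes>\<^bsub>B\<^esub> t' k)" for k
      using s(1)[of k] s'(1)[of k] same_poly_mult by blast
  qed (use s s' in \<open>simp_all add: A.tends_mult B.tends_mult\<close>)
qed

lemma same_limit_smult:
  assumes "same_limit x y"
  shows "same_limit (c \<odot>\<^bsub>A\<^esub> x) (c \<odot>\<^bsub>B\<^esub> y)"
proof -
  obtain s t where s: "\<And>k. \<exists>n. sp n (s k) (t k)" "A.tends s x" "B.tends t y"
    "x \<in> carrier A" "y \<in> carrier B" "\<And>k. s k \<in> carrier A" "\<And>k. t k \<in> carrier B"
    using same_limitE[OF assms(1)] by metis
  show ?thesis
  proof (rule same_limitI[where s = "\<lambda>k. c \<odot>\<^bsub>A\<^esub> s k" and t = "\<lambda>k. c \<odot>\<^bsub>B\<^esub> t k"])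
    show "\<exists>n. sp n (c \<odot>\<^bsub>A\<^esub> s k) (c \<odot>\<^bsub>B\<^esub> t k)" for k
      using s(1)[of k] same_poly_smult by blast
  qed (use s in \<open>simp_all add: A.tends_smult B.tends_smult\<close>)
qed

lemma same_limit_adj:
  assumes "same_limit x y"
  shows "same_limit (adj A x) (adj B y)"
proof -
  obtain s t where s: "\<And>k. \<exists>n. sp n (s k) (t k)" "A.tends s x" "B.tends t y"
    "x \<in> carrier A" "y \<in> carrier B" "\<And>k. s k \<in> carrier A" "\<And>k. t k \<in> carrier B"
    using same_limitE[OF assms(1)] by metis
  show ?thesis
  proof (rule same_limitI[where s = "\<lambda>k. adj A (s k)" and t = "\<lambda>k. adj B (t k)"])
    show "\<exists>n. sp n (adj A (s k)) (adj B (t k))" for k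
      using s(1)[of k] same_poly_adj by blast
  qed (use s in \<open>simp_all add: A.tends_adj B.tends_adj\<close>)
qed

lemma same_limit_minus:
  assumes "same_limit x y" "same_limit x' y'"
  shows "same_limit (x \<ominus>\<^bsub>A\<^esub> x') (y \<ominus>\<^bsub>B\<^esub> y')"
  using same_limit_add[OF assms(1) same_limit_smult[OF assms(2), of "-1"]]
    same_limit_in[OF assms(1)] same_limit_in[OF assms(2)]
  by (simp add: A.minus_eq_smult B.minus_eq_smult)

lemma same_limit_approx:
  assumes "same_limit x y" "e > 0"
  shows "\<exists>n p q. sp n p q \<and> cnorm A (p \<ominus>\<^bsub>A\<^esub> x) < e \<and> cnorm B (q \<ominus>\<^bsub>B\<^esub> y) < e"
proof -
  obtain s t where s: "\<And>k. \<exists>n. sp n (s k) (t k)" "A.tends s x" "B.tends t y"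
    using same_limitE[OF assms(1)] by metis
  have "\<forall>\<^sub>F k in sequentially. cnorm A (s k \<ominus>\<^bsub>A\<^esub> x) < e \<and> cnorm B (t k \<ominus>\<^bsub>B\<^esub> y) < e"
    using order_tendstoD(2)[OF s(2)[unfolded A.tends_def] assms(2)]
      order_tendstoD(2)[OF s(3)[unfolded B.tends_def] assms(2)] by eventually_elim simp
  then obtain k where "cnorm A (s k \<ominus>\<^bsub>A\<^esub> x) < e" "cnorm B (t k \<ominus>\<^bsub>B\<^esub> y) < e"
    using eventually_happens'[OF sequentially_bot] by blast
  then show ?thesis
    using s(1)[of k] by blast
qed

text \<open>
  Replace each \<open>(s k, t k)\<close> by a pair of polynomial values at distance less than \<open>1 / (k + 1)\<close>.
\<close>

lemma same_limit_limit:
  assumes st: "\<And>k. same_limit (s k) (t k)" and x: "A.tends s x" "x \<in> carrier A"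
    and y: "B.tends t y" "y \<in> carrier B"
  shows "same_limit x y"
proof -
  have "\<exists>p q. (\<exists>n. sp n p q) \<and> cnorm A (p \<ominus>\<^bsub>A\<^esub> s k) < inverse (Suc k)
      \<and> cnorm B (q \<ominus>\<^bsub>B\<^esub> t k) < inverse (Suc k)" for k
    using same_limit_approx[OF st, of "inverse (Suc k)" k] by auto
  then obtain p q where pq: "\<And>k. \<exists>n. sp n (p k) (q k)"
    and p: "\<And>k. cnorm A (p k \<ominus>\<^bsub>A\<^esub> s k) < inverse (Suc k)"
    and q: "\<And>k. cnorm B (q k \<ominus>\<^bsub>B\<^esub> t k) < inverse (Suc k)"
    by metis
  have c: "p k \<in> carrier A" "q k \<in> carrier B" "s k \<in> carrier A" "t k \<in> carrier B" for k
    using same_poly_in pq[of k] same_limit_in[OF st[of k]] by auto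
  have lim: "(\<lambda>k. inverse (real (Suc k)) + cnorm A (s k \<ominus>\<^bsub>A\<^esub> x)) \<longlonglongrightarrow> 0"
    "(\<lambda>k. inverse (real (Suc k)) + cnorm B (t k \<ominus>\<^bsub>B\<^esub> y)) \<longlonglongrightarrow> 0"
    using tendsto_add[OF LIMSEQ_inverse_real_of_nat x(1)[unfolded A.tends_def]]
      tendsto_add[OF LIMSEQ_inverse_real_of_nat y(1)[unfolded B.tends_def]] by simp_all
  have le: "cnorm A (p k \<ominus>\<^bsub>A\<^esub> x) \<le> inverse (real (Suc k)) + cnorm A (s k \<ominus>\<^bsub>A\<^esub> x)"
    and le': "cnorm B (q k \<ominus>\<^bsub>B\<^esub> y) \<le> inverse (real (Suc k)) + cnorm B (t k \<ominus>\<^bsub>B\<^esub> y)" for k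
    using A.dist_triangle[OF c(1) c(3) x(2), of k k] B.dist_triangle[OF c(2) c(4) y(2), of k k]
      p[of k] q[of k] by simp_all
  show ?thesis
    by (rule same_limitI[OF pq A.tends_le[OF le lim(1) c(1) x(2)]
          B.tends_le[OF le' lim(2) c(2) y(2)] x(2) y(2)])
qed

end

lemma same_limit_sym:
  assumes "cstar_element_pair A v B w"
  shows "cstar_element_pair.same_limit A v B w x y \<longleftrightarrow> cstar_element_pair.same_limit B w A v y x"
proof -
  interpret AB: cstar_element_pair A v B w by fact
  interpret BA: cstar_element_pair B w A v ..
  show ?thesis
    unfolding AB.same_limit_def BA.same_limit_def using same_poly_sym by metis
qed

text \<open>
  A contractive correspondence of polynomial values has a closure that is again contractive,
  and therefore the graph of a function.
\<close>

locale contractive_pair = cstar_element_pair +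
  assumes contractive: "same_poly A v B w n x y \<Longrightarrow> cnorm B y \<le> cnorm A x"
begin

lemma same_limit_le:
  assumes "same_limit x y"
  shows "cnorm B y \<le> cnorm A x"
proof -
  obtain s t where s: "\<And>k. \<exists>n. sp n (s k) (t k)" "A.tends s x" "B.tends t y"
    "x \<in> carrier A" "y \<in> carrier B" "\<And>k. s k \<in> carrier A" "\<And>k. t k \<in> carrier B"
    using same_limitE[OF assms(1)] by metis
  show ?thesis
  proof (rule LIMSEQ_le)
    show "(\<lambda>k. cnorm B (t k)) \<longlonglongrightarrow> cnorm B y" "(\<lambda>k. cnorm A (s k)) \<longlonglongrightarrow> cnorm A x"
      using s by (auto intro: A.tends_cnorm B.tends_cnorm)
    show "\<exists>N. \<forall>k\<ge>N. cnorm B (t k) \<le> cnorm A (s k)"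
      using s(1) contractive by blast
  qed
qed

lemma same_limit_unique:
  assumes "same_limit x y" "same_limit x y'"
  shows "y = y'"
proof -
  note in_carrier = same_limit_in[OF assms(1)] same_limit_in[OF assms(2)]
  have "cnorm B (y \<ominus>\<^bsub>B\<^esub> y') \<le> cnorm A (x \<ominus>\<^bsub>A\<^esub> x)"
    using same_limit_minus[OF assms] by (rule same_limit_le)
  then have "cnorm B (y \<ominus>\<^bsub>B\<^esub> y') = 0"
    using in_carrier B.cnorm_nonneg[of "y \<ominus>\<^bsub>B\<^esub> y'"] A.dist_eq_zero_iff[of x x] by simp
  then show ?thesis
    using in_carrier B.dist_eq_zero_iff by simp
qed

text \<open>
  Contractivity makes the second components of a convergent sequence of pairs Cauchy whenever
  the first components converge, so no limit point is lost.
\<close>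

lemma same_limit_domain:
  "cstar_subalgebra {x. \<exists>y. same_limit x y} A"
proof (rule cstar_subalgebraI)
  show "cstar_algebra A" ..
  show "{x. \<exists>y. same_limit x y} \<subseteq> carrier A"
    using same_limit_in by auto
  show "\<zero>\<^bsub>A\<^esub> \<in> {x. \<exists>y. same_limit x y}"
    using same_limit_poly[OF same_poly.zero] by blast
next
  fix s x assume s: "\<And>k. s k \<in> {x. \<exists>y. same_limit x y}" and x: "x \<in> carrier A" "A.tends s x"
  then have "\<forall>k. \<exists>y. same_limit (s k) y"
    by simp
  from choice[OF this] obtain t where st: "\<And>k. same_limit (s k) (t k)"
    by blast
  have sA: "s k \<in> carrier A" and tB: "t k \<in> carrier B" for k
    using same_limit_in[OF st[of k]] by simp_all
  have "\<exists>N. \<forall>m\<ge>N. \<forall>n\<ge>N. cnorm B (t m \<ominus>\<^bsub>B\<^esub> t n) < e" if e: "e > 0" for e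
  proof -
    obtain N where N: "\<And>m n. m \<ge> N \<Longrightarrow> n \<ge> N \<Longrightarrow> cnorm A (s m \<ominus>\<^bsub>A\<^esub> s n) < e"
      using A.tends_Cauchy[OF x(2) sA x(1) e] by blast
    have "cnorm B (t m \<ominus>\<^bsub>B\<^esub> t n) < e" if "m \<ge> N" "n \<ge> N" for m n
      using same_limit_le[OF same_limit_minus[OF st st]] N[OF that] by (rule order.strict_trans1)
    then show ?thesis by blast
  qed
  from B.complete[OF tB this] obtain y where "y \<in> carrier B" "B.tends t y"
    unfolding B.tends_def by blast
  then show "x \<in> {x. \<exists>y. same_limit x y}"
    using same_limit_limit[OF st x(2,1)] by blast
next
  fix x y c assume "x \<in> {x. \<exists>y. same_limit x y}" "y \<in> {x. \<exists>y. same_limit x y}"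
  then obtain x' y' where "same_limit x x'" "same_limit y y'"
    by blast
  note add = same_limit_add[OF this] and mult = same_limit_mult[OF this]
    and smult = same_limit_smult[OF this(1)] and adj = same_limit_adj[OF this(1)]
  show "x \<oplus>\<^bsub>A\<^esub> y \<in> {x. \<exists>y. same_limit x y}" "x \<otimes>\<^bsub>A\<^esub> y \<in> {x. \<exists>y. same_limit x y}"
    "c \<odot>\<^bsub>A\<^esub> x \<in> {x. \<exists>y. same_limit x y}" "adj A x \<in> {x. \<exists>y. same_limit x y}"
    using add mult smult adj by blast+
qed

text \<open>
  The domain of the closed graph is a C*-subalgebra containing \<open>v\<close>, hence everything.
\<close>

theorem star_hom_exists:
  assumes "cstar_generated A v = carrier A"
  shows "\<exists>h\<in>star_hom A B. h v = w \<and> (\<forall>x\<in>carrier A. same_limit x (h x))"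
proof -
  have vw: "same_limit v w"
    using same_limit_poly[OF same_poly_letter[of 1 True]] by (simp add: letter_def)
  have "carrier A \<subseteq> {x. \<exists>y. same_limit x y}"
    using same_limit_domain vw unfolding assms[symmetric] cstar_generated_def by blast
  then have "\<forall>x\<in>carrier A. \<exists>y. same_limit x y"
    by blast
  from bchoice[OF this] obtain h where h: "\<And>x. x \<in> carrier A \<Longrightarrow> same_limit x (h x)"
    by blast
  have eq: "h x = y" if "same_limit x y" for x y
    using same_limit_unique[OF h that] same_limit_in[OF that] by blast
  have "h \<in> carrier A \<rightarrow> carrier B"
    using same_limit_in[OF h] by blast
  then have "h \<in> star_hom A B"
    unfolding star_hom_def
    by (simp add: eq h same_limit_add same_limit_smult same_limit_mult same_limit_adj)
  then show ?thesis
    using h eq[OF vw] by blast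
qed

end

text \<open>
  A *-homomorphism is only assumed to be algebraic. On polynomial values this already
  determines it, before anything is known about its continuity.
\<close>

lemma same_poly_star_hom:
  assumes "cstar_algebra A" "v \<in> carrier A" "cstar_algebra B" "h \<in> star_hom A B" "h v = w"
    and "same_poly A v B w n x y"
  shows "h x = y"
proof -
  interpret A: cstar_element A v using assms by (intro cstar_element.intro cstar_element_axioms.intro)
  interpret B: cstar_algebra B by fact
  have w: "w \<in> carrier B"
    using assms(2,4,5) by (auto simp: star_hom_def)
  interpret B: cstar_element B w by unfold_locales (rule w)
  interpret cstar_element_pair A v B w ..
  have h: "\<And>x y. \<lbrakk>x \<in> carrier A; y \<in> carrier A\<rbrakk> \<Longrightarrow> h (x \<oplus>\<^bsub>A\<^esub> y) = h x \<oplus>\<^bsub>B\<^esub> h y"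
    "\<And>c x. x \<in> carrier A \<Longrightarrow> h (c \<odot>\<^bsub>A\<^esub> x) = c \<odot>\<^bsub>B\<^esub> h x"
    "\<And>x y. \<lbrakk>x \<in> carrier A; y \<in> carrier A\<rbrakk> \<Longrightarrow> h (x \<otimes>\<^bsub>A\<^esub> y) = h x \<otimes>\<^bsub>B\<^esub> h y"
    "\<And>x. x \<in> carrier A \<Longrightarrow> h (adj A x) = adj B (h x)"
    "\<And>x. x \<in> carrier A \<Longrightarrow> h x \<in> carrier B"
    using assms(4) by (auto simp: star_hom_def)
  have letter: "h (letter A v b) = letter B w b" for b
    using h(4)[of v] by (simp add: letter_def assms(5))
  have word: "u \<noteq> [] \<Longrightarrow> h (word_val A v u) = word_val B w u" for u
    by (induction u rule: list_nonempty_induct) (simp_all add: word_val_Cons h letter)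
  have zero: "h \<zero>\<^bsub>A\<^esub> = \<zero>\<^bsub>B\<^esub>"
    using h(2)[of "\<zero>\<^bsub>A\<^esub>" 0] h(5)[of "\<zero>\<^bsub>A\<^esub>"] by simp
  show ?thesis
    using assms(6)
  proof (induction rule: same_poly.induct)
    case (step x y u c)
    then show ?case
      using same_poly_in[OF step.hyps(1)] by (simp add: h word)
  qed (rule zero)
qed

text \<open>
  The two *-homomorphisms have the same closed graph, read in opposite directions.
\<close>

theorem isometric_star_isomorphic:
  assumes "contractive_pair A v B w" "contractive_pair B w A v"
    and "cstar_generated A v = carrier A" "cstar_generated B w = carrier B"
  shows "star_isomorphic A B"
proof -
  interpret AB: contractive_pair A v B w by fact
  interpret BA: contractive_pair B w A v by fact
  note sym = same_limit_sym[OF AB.cstar_element_pair_axioms]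
  obtain h where h: "h \<in> star_hom A B" "\<And>x. x \<in> carrier A \<Longrightarrow> AB.same_limit x (h x)"
    using AB.star_hom_exists[OF assms(3)] by blast
  obtain k where k: "k \<in> star_hom B A" "\<And>y. y \<in> carrier B \<Longrightarrow> BA.same_limit y (k y)"
    using BA.star_hom_exists[OF assms(4)] by blast
  have hk: "h \<in> carrier A \<rightarrow> carrier B" "k \<in> carrier B \<rightarrow> carrier A"
    using h(1) k(1) by (auto simp: star_hom_def)
  have "k (h x) = x" if "x \<in> carrier A" for x
    using BA.same_limit_unique[of "h x" "k (h x)" x] k(2)[of "h x"] h(2)[OF that] hk that sym by auto
  moreover have "h (k y) = y" if "y \<in> carrier B" for y
    using AB.same_limit_unique[of "k y" "h (k y)" y] h(2)[of "k y"] k(2)[OF that] hk that sym by auto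
  ultimately have "bij_betw h (carrier A) (carrier B)"
    using hk by (intro bij_betw_byWitness[where f' = k]) auto
  then show ?thesis
    using h(1) by (auto simp: star_isomorphic_def)
qed

section \<open>Polynomials in the truncated shifts\<close>

lemma shift_sections_mat [simp]: "shift_sections n \<in> carrier_mat n n"
  by (simp add: shift_sections_def section_mat_def)

lemma shift_sections_index:
  "i < n \<Longrightarrow> j < n \<Longrightarrow> shift_sections n $$ (i, j) = of_bool (i = Suc j)"
  by (auto simp: shift_sections_def section_mat_def trunc_def fwd_shift_def split: nat.split)

lemma shift_mult_index:
  assumes "X \<in> carrier_mat n m" "i < n" "j < m"
  shows "(shift_sections n * X) $$ (i, j) = (if 1 \<le> i then X $$ (i - 1, j) else 0)"
proof -
  have "(shift_sections n * X) $$ (i, j) = (\<Sum>k<n. shift_sections n $$ (i, k) * X $$ (k, j))"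
    using assms carrier_matD[OF shift_sections_mat[of n]]
    by (simp add: scalar_prod_def atLeast0LessThan)
  also have "\<dots> = (\<Sum>k<n. if k = i - 1 then (if 1 \<le> i then X $$ (k, j) else 0) else 0)"
    using assms(2) by (intro sum.cong) (auto simp: shift_sections_index)
  finally show ?thesis
    using assms(2) by (auto simp: sum.delta)
qed

lemma shift_adjoint_mult_index:
  assumes "X \<in> carrier_mat n m" "i < n" "j < m"
  shows "(mat_adjoint (shift_sections n) * X) $$ (i, j) = (if i + 1 < n then X $$ (i + 1, j) else 0)"
proof -
  have "(mat_adjoint (shift_sections n) * X) $$ (i, j)
      = (\<Sum>k<n. mat_adjoint (shift_sections n) $$ (i, k) * X $$ (k, j))"
    using assms carrier_matD[OF shift_sections_mat[of n]]
    by (simp add: scalar_prod_def atLeast0LessThan)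
  also have "\<dots> = (\<Sum>k<n. if k = i + 1 then X $$ (k, j) else 0)"
    using assms(2) carrier_matD[OF shift_sections_mat[of n]]
    by (intro sum.cong) (auto simp: shift_sections_index)
  finally show ?thesis
    by (simp add: sum.delta)
qed

text \<open>
  As for \<open>cnorm_element_le_1\<close>, at the level of a single block. This is what bounds the blocks
  of the shift uniformly.
\<close>

lemma mat_opnorm_partial_isometry:
  assumes "M \<in> carrier_mat n n" "M * (mat_adjoint M * M) = M"
  shows "mat_opnorm M \<le> 1"
proof -
  let ?P = "mat_adjoint M * M"
  have P: "?P \<in> carrier_mat n n" and adj: "mat_adjoint ?P = ?P"
    using assms(1) mat_adjoint_mult[OF mat_adjoint_carrier[OF assms(1)] assms(1)] by auto
  have "?P * ?P = ?P"
    using assoc_mult_mat[OF mat_adjoint_carrier[OF assms(1)] assms(1) P] assms(2) by simp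
  then have "(mat_opnorm ?P)\<^sup>2 = mat_opnorm ?P"
    using mat_opnorm_adjoint_mult[of ?P] by (simp only: adj)
  then have "(mat_opnorm M)\<^sup>2 = 0 \<or> (mat_opnorm M)\<^sup>2 = 1"
    by (simp add: mat_opnorm_adjoint_mult power2_eq_square)
  then show ?thesis
    using power2_le_imp_le[of "mat_opnorm M" 1] by auto
qed

lemma shift_sections_in: "shift_sections \<in> carrier mat_seq_algebra"
proof (rule mat_seqI)
  fix n :: nat
  let ?V = "shift_sections n"
  have d: "dim_row ?V = n" "dim_col ?V = n"
    using carrier_matD[OF shift_sections_mat[of n]] by simp_all
  have "?V * (mat_adjoint ?V * ?V) = ?V"
  proof (rule eq_matI)
    fix i j assume ij: "i < dim_row ?V" "j < dim_col ?V"
    have "mat_adjoint ?V * ?V \<in> carrier_mat n n"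
      by (intro carrier_matI) (simp_all add: d)
    then show "(?V * (mat_adjoint ?V * ?V)) $$ (i, j) = ?V $$ (i, j)"
      using ij shift_mult_index[of "mat_adjoint ?V * ?V" n n i j]
        shift_adjoint_mult_index[of ?V n n "i - 1" j]
      by (auto simp: d shift_sections_index)
  qed (simp_all add: d)
  then show "mat_opnorm ?V \<le> 1"
    by (rule mat_opnorm_partial_isometry[OF shift_sections_mat])
qed simp

interpretation F: cstar_element mat_seq_algebra shift_sections
  by (intro cstar_element.intro cstar_algebra_mat_seq cstar_element_axioms.intro shift_sections_in)

text \<open>
  Multiplying by a truncated shift from the left moves the rows down, and multiplying by its
  adjoint moves them up; rows that leave the matrix are replaced by zeros.
\<close>

lemma word_act_shift_True:
  assumes "X \<in> carrier mat_seq_algebra" "i < n" "j < n"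
  shows "word_act mat_seq_algebra shift_sections (replicate m True) X n $$ (i, j) =
    (if m \<le> i then X n $$ (i - m, j) else 0)"
  using assms(2)
proof (induction m arbitrary: i)
  case (Suc m)
  have "word_act mat_seq_algebra shift_sections (replicate m True) X \<in> carrier mat_seq_algebra"
    using assms(1) by (rule F.word_act_in)
  from shift_mult_index[OF mat_seq_carrier_mat[OF this], of i n j] show ?case
    using Suc.prems Suc.IH[of "i - 1"] assms(3) by (auto simp: letter_def)
qed simp

lemma word_act_shift_False:
  assumes "X \<in> carrier mat_seq_algebra" "i < n" "j < n"
  shows "word_act mat_seq_algebra shift_sections (replicate m False) X n $$ (i, j) =
    (if i + m < n then X n $$ (i + m, j) else 0)"
  using assms(2)
proof (induction m arbitrary: i)
  case (Suc m)
  have "word_act mat_seq_algebra shift_sections (replicate m False) X \<in> carrier mat_seq_algebra"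
    using assms(1) by (rule F.word_act_in)
  from shift_adjoint_mult_index[OF mat_seq_carrier_mat[OF this], of i n j] show ?case
    using Suc.prems Suc.IH[of "i + 1"] assms(3) by (auto simp: letter_def)
qed simp

text \<open>
  Moving the rows up and down again by \<open>m + 1\<close> deletes the first \<open>m + 1\<close> rows, which vanish in
  the power with exponent \<open>m + 1\<close>.
\<close>

theorem power_partial_isometry_shift_sections:
  "power_partial_isometry mat_seq_algebra shift_sections"
  unfolding power_partial_isometry_def partial_isometry_def
proof (intro allI conjI F.pow_in)
  fix m
  let ?F = mat_seq_algebra and ?V = shift_sections
  let ?P = "pow_Suc ?F ?V m"
  have P: "?P n $$ (i, j) = 0" if "i \<le> m" "i < n" "j < n" for n i j
  proof (cases m)
    case (Suc k)
    have "?P = word_act ?F ?V (replicate (Suc k) True) ?V"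
      using F.word_act_True[OF F.element_in, of k] Suc by simp
    then show ?thesis
      using that Suc by (auto simp only: word_act_shift_True[OF F.element_in] shift_sections_index) auto
  qed (use that in \<open>simp add: shift_sections_index\<close>)
  have "?P \<otimes>\<^bsub>?F\<^esub> adj ?F ?P \<otimes>\<^bsub>?F\<^esub> ?P = ?P \<otimes>\<^bsub>?F\<^esub> (adj ?F ?P \<otimes>\<^bsub>?F\<^esub> ?P)"
    by (intro F.mult_assoc F.adj_closed F.pow_in)
  also have "\<dots> = word_act ?F ?V (replicate (Suc m) True) (word_act ?F ?V (replicate (Suc m) False) ?P)"
    by (simp only: F.word_act_True F.word_act_False F.pow_in F.mult_closed F.adj_closed)
  also have "\<dots> = ?P"
  proof (rule mat_seq_eqI)
    fix n i j :: nat assume "i < n" "j < n"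
    then show "word_act ?F ?V (replicate (Suc m) True) (word_act ?F ?V (replicate (Suc m) False) ?P) n $$ (i, j)
        = ?P n $$ (i, j)"
      using P[of i n j]
      by (simp add: word_act_shift_True[OF F.word_act_in] word_act_shift_False del: replicate_Suc)
  qed (intro F.word_act_in F.pow_in)+
  finally show "?P \<otimes>\<^bsub>?F\<^esub> adj ?F ?P \<otimes>\<^bsub>?F\<^esub> ?P = ?P" .
qed

interpretation F: ppi mat_seq_algebra shift_sections
  by (intro ppi.intro cstar_algebra_mat_seq ppi_axioms.intro power_partial_isometry_shift_sections)

text \<open>
  The unit of the algebra of all sequences. It lies outside the algebra generated by the
  shifts, but it turns the value of a word into an action, for which rows can be tracked.
\<close>

definition seq_one :: "nat \<Rightarrow> complex mat" where
  "seq_one n = 1\<^sub>m n"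

lemma seq_one_in [simp]: "seq_one \<in> carrier mat_seq_algebra"
proof (rule mat_seqI)
  show "mat_opnorm (seq_one n) \<le> 1" for n
    by (rule mat_opnorm_least) (simp add: seq_one_def)
qed (simp add: seq_one_def)

lemma mult_seq_one:
  "X \<in> carrier mat_seq_algebra \<Longrightarrow> X \<otimes>\<^bsub>mat_seq_algebra\<^esub> seq_one = X"
  using right_mult_one_mat[OF mat_seq_carrier_mat] by (simp add: seq_one_def)

lemma word_val_shift:
  "u \<noteq> [] \<Longrightarrow> word_val mat_seq_algebra shift_sections u = word_act mat_seq_algebra shift_sections u seq_one"
  using F.word_val_mult[OF _ seq_one_in, of u] mult_seq_one[OF F.word_val_in, of u] by simp

text \<open>
  Entry \<open>(i, j)\<close> of block \<open>n\<close> of the normal form \<open>v\<^sup>a (v\<^sup>*)\<^sup>a\<^sup>+\<^sup>b v\<^sup>d\<close>.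
\<close>

fun std_entry :: "nat \<Rightarrow> nat \<Rightarrow> nat \<Rightarrow> nat \<times> nat \<times> nat \<Rightarrow> complex" where
  "std_entry n i j (a, b, d) = of_bool (a \<le> i \<and> i + b < n \<and> i + b = j + d)"

lemma word_val_std_index:
  assumes "t \<in> triples N" "i < n" "j < n"
  shows "word_val mat_seq_algebra shift_sections (std_word t) n $$ (i, j) = std_entry n i j t"
proof -
  obtain a b d where t: "t = (a, b, d)" by (cases t) auto
  have 1: "seq_one n $$ (p, j) = of_bool (p = j)" if "p < n" for p
    using that assms(3) by (simp add: seq_one_def)
  have "word_val mat_seq_algebra shift_sections (std_word t) =
      word_act mat_seq_algebra shift_sections (std_word t) seq_one"
    by (rule word_val_shift[OF std_word_nonempty[OF assms(1)]])
  then show ?thesis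
    unfolding t std_word.simps word_act_append
    using assms(2,3)
    by (auto simp: word_act_shift_True word_act_shift_False 1)
qed

lemma finsum_mat_seq_index:
  assumes "finite T" "\<And>t. t \<in> T \<Longrightarrow> f t \<in> carrier mat_seq_algebra" "i < n" "j < n"
  shows "(\<Oplus>\<^bsub>mat_seq_algebra\<^esub>t\<in>T. c t \<odot>\<^bsub>mat_seq_algebra\<^esub> f t) n $$ (i, j) = (\<Sum>t\<in>T. c t * f t n $$ (i, j))"
  using assms(1,2)
proof (induction T)
  case empty
  then show ?case using assms(3,4) by simp
next
  case (insert t T)
  have f: "f t \<in> carrier mat_seq_algebra" "f \<in> T \<rightarrow> carrier mat_seq_algebra"
    using insert.prems by auto
  let ?s = "\<Oplus>\<^bsub>mat_seq_algebra\<^esub>t\<in>T. c t \<odot>\<^bsub>mat_seq_algebra\<^esub> f t"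
  have s: "?s \<in> carrier mat_seq_algebra"
    using f by (intro F.finsum_closed Pi_I F.smult_in) auto
  have "(\<Oplus>\<^bsub>mat_seq_algebra\<^esub>t\<in>insert t T. c t \<odot>\<^bsub>mat_seq_algebra\<^esub> f t)
      = c t \<odot>\<^bsub>mat_seq_algebra\<^esub> f t \<oplus>\<^bsub>mat_seq_algebra\<^esub> ?s"
    using f insert.hyps by (intro F.finsum_insert Pi_I F.smult_in) auto
  then have "(\<Oplus>\<^bsub>mat_seq_algebra\<^esub>t\<in>insert t T. c t \<odot>\<^bsub>mat_seq_algebra\<^esub> f t) n $$ (i, j)
      = c t * f t n $$ (i, j) + ?s n $$ (i, j)"
    using mat_seq_carrier_mat[OF f(1), of n] mat_seq_carrier_mat[OF s, of n] assms(3,4) by simp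
  then show ?case
    using insert by simp
qed

text \<open>
  Moebius inversion. On the diagonal \<open>d - b = i - j\<close>, entry \<open>(i, j)\<close> of block \<open>n\<close> is the sum of the
  coefficients over the rectangle \<open>a \<le> i\<close>, \<open>b < n - i\<close>. A single coefficient is thus an alternating
  sum over the four rectangles with corners next to \<open>(a, b)\<close>.
\<close>

lemma coefficient_bound:
  assumes bound: "\<And>n i j. \<lbrakk>i < n; j < n\<rbrakk> \<Longrightarrow> cmod (\<Sum>t\<in>triples N. c t * std_entry n i j t) \<le> K"
    and t: "t \<in> triples N"
  shows "cmod (c t) \<le> 4 * K"
proof -
  obtain a b d where t_eq: "t = (a, b, d)" by (cases t) auto
  define k where "k = int d - int b"
  define I :: "nat \<Rightarrow> nat \<Rightarrow> nat \<times> nat \<times> nat \<Rightarrow> complex" where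
    "I P Q = (\<lambda>(a, b, d). of_bool (a < P \<and> b < Q \<and> int d = int b + k))" for P Q
  \<comment> \<open>The sum over \<open>a < P\<close>, \<open>b < Q\<close> on the diagonal through \<open>t\<close>. It is the entry of block
    \<open>P - 1 + Q\<close> in row \<open>P - 1\<close> and column \<open>P - 1 - k\<close>, or zero if there is no such entry.\<close>
  define G where "G P Q = (\<Sum>s\<in>triples N. c s * I P Q s)" for P Q
  have "0 \<le> K"
    using order.trans[OF norm_ge_zero bound[of 0 1 0]] by simp
  have G: "cmod (G P Q) \<le> K" for P Q
  proof (cases "\<exists>i j. P = Suc i \<and> 0 < Q \<and> j < i + Q \<and> int j = int i - k")
    case True
    then obtain i j where ij: "P = Suc i" "0 < Q" "j < i + Q" "int j = int i - k" by blast
    have "I P Q s = std_entry (i + Q) i j s" for s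
      using ij by (cases s) (auto simp: I_def)
    then show ?thesis
      using bound[of i "i + Q" j] ij(2,3) by (simp add: G_def)
  next
    case False
    \<comment> \<open>For a summand, \<open>d \<le> a + b\<close> makes the column \<open>P - 1 - k\<close> nonnegative, and \<open>d \<ge> 0\<close> keeps it
      below \<open>P - 1 + Q\<close>. So there are no summands here.\<close>
    have "I P Q s = 0" if "s \<in> triples N" for s
    proof (rule ccontr)
      assume "I P Q s \<noteq> 0"
      then obtain a' b' d' where s: "s = (a', b', d')" "a' < P" "b' < Q" "int d' = int b' + k"
        by (cases s) (auto simp: I_def split: if_splits)
      moreover have "d' \<le> a' + b'"
        using that s(1) by (simp add: triples_def)
      ultimately have "P = Suc (P - 1) \<and> 0 < Q \<and> nat (int (P - 1) - k) < P - 1 + Q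
          \<and> int (nat (int (P - 1) - k)) = int (P - 1) - k"
        by auto
      then show False using False by blast
    qed
    then show ?thesis
      using \<open>0 \<le> K\<close> by (simp add: G_def)
  qed
  have corner: "I (Suc a) (Suc b) s - I a (Suc b) s - (I (Suc a) b s - I a b s) = of_bool (s = t)" for s
    by (cases s) (auto simp: I_def t_eq k_def of_bool_def less_Suc_eq)
  have "c t = (\<Sum>s\<in>triples N. if s = t then c s else 0)"
    using t by simp
  also have "\<dots> = (\<Sum>s\<in>triples N. c s * of_bool (s = t))"
    by (intro sum.cong) auto
  also have "\<dots> = (\<Sum>s\<in>triples N. c s * I (Suc a) (Suc b) s - c s * I a (Suc b) s
      - (c s * I (Suc a) b s - c s * I a b s))"
    by (simp only: corner[symmetric] right_diff_distrib)
  also have "\<dots> = (G (Suc a) (Suc b) - G a (Suc b)) - (G (Suc a) b - G a b)"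
    by (simp only: G_def sum_subtractf)
  finally have c: "c t = (G (Suc a) (Suc b) - G a (Suc b)) - (G (Suc a) b - G a b)" .
  have "cmod (c t) \<le> (cmod (G (Suc a) (Suc b)) + cmod (G a (Suc b))) + (cmod (G (Suc a) b) + cmod (G a b))"
    unfolding c by (intro order.trans[OF norm_triangle_ineq4] add_mono norm_triangle_ineq4)
  then show ?thesis
    using G[of "Suc a" "Suc b"] G[of a "Suc b"] G[of "Suc a" b] G[of a b] by simp
qed

locale shift_ppi_pair = B: ppi B w for B :: "'b cstar" and w

sublocale shift_ppi_pair \<subseteq> ppi_pair mat_seq_algebra shift_sections B w ..

context shift_ppi_pair
begin

lemma same_poly_coefficients:
  assumes "sp N x y"
  obtains c where
    "x = (\<Oplus>\<^bsub>mat_seq_algebra\<^esub>t\<in>triples N. c t \<odot>\<^bsub>mat_seq_algebra\<^esub>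
      word_val mat_seq_algebra shift_sections (std_word t))"
    "y = (\<Oplus>\<^bsub>B\<^esub>t\<in>triples N. c t \<odot>\<^bsub>B\<^esub> word_val B w (std_word t))"
    "\<And>n i j. \<lbrakk>i < n; j < n\<rbrakk> \<Longrightarrow> x n $$ (i, j) = (\<Sum>t\<in>triples N. c t * std_entry n i j t)"
proof -
  obtain c where c: "x = (\<Oplus>\<^bsub>mat_seq_algebra\<^esub>t\<in>triples N. c t \<odot>\<^bsub>mat_seq_algebra\<^esub>
      word_val mat_seq_algebra shift_sections (std_word t))"
    "y = (\<Oplus>\<^bsub>B\<^esub>t\<in>triples N. c t \<odot>\<^bsub>B\<^esub> word_val B w (std_word t))"
    using same_poly_std[OF assms] by blast
  have "x n $$ (i, j) = (\<Sum>t\<in>triples N. c t * std_entry n i j t)" if "i < n" "j < n" for n i j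
    unfolding c(1) finsum_mat_seq_index[OF finite_triples F.word_val_in that]
    using word_val_std_index[OF _ that] by (intro sum.cong) simp_all
  with c show thesis by (rule that)
qed

text \<open>
  There are at most \<open>(N + 1)\<^sup>3\<close> normal forms, all of norm at most one, and each coefficient is at
  most \<open>4 K\<close>. The estimate holds on either side because the coefficients are shared.
\<close>

lemma same_poly_bound:
  assumes "sp N x y" and bound: "\<And>n i j. \<lbrakk>i < n; j < n\<rbrakk> \<Longrightarrow> cmod (x n $$ (i, j)) \<le> K"
  shows "cnorm mat_seq_algebra x \<le> 4 * (real N + 1) ^ 3 * K"
    and "cnorm B y \<le> 4 * (real N + 1) ^ 3 * K"
proof -
  obtain c where c: "x = (\<Oplus>\<^bsub>mat_seq_algebra\<^esub>t\<in>triples N. c t \<odot>\<^bsub>mat_seq_algebra\<^esub>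
      word_val mat_seq_algebra shift_sections (std_word t))"
    "y = (\<Oplus>\<^bsub>B\<^esub>t\<in>triples N. c t \<odot>\<^bsub>B\<^esub> word_val B w (std_word t))"
    "\<And>n i j. \<lbrakk>i < n; j < n\<rbrakk> \<Longrightarrow> x n $$ (i, j) = (\<Sum>t\<in>triples N. c t * std_entry n i j t)"
    using same_poly_coefficients[OF assms(1)] by blast
  have "0 \<le> K"
    using order.trans[OF norm_ge_zero bound[of 0 1 0]] by simp
  have "cmod (\<Sum>t\<in>triples N. c t * std_entry n i j t) \<le> K" if "i < n" "j < n" for n i j
    using bound[OF that] c(3)[OF that] by simp
  then have "(\<Sum>t\<in>triples N. cmod (c t)) \<le> (\<Sum>t\<in>triples N. 4 * K)"
    by (intro sum_mono coefficient_bound)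
  also have "\<dots> = real (card (triples N)) * (4 * K)"
    by simp
  also have "\<dots> \<le> (real N + 1) ^ 3 * (4 * K)"
    using of_nat_mono[OF card_triples[of N], where 'a = real] \<open>0 \<le> K\<close>
    by (intro mult_right_mono) (simp_all add: add.commute)
  finally have sum: "(\<Sum>t\<in>triples N. cmod (c t)) \<le> 4 * (real N + 1) ^ 3 * K"
    by simp
  have "cnorm mat_seq_algebra x \<le> (\<Sum>t\<in>triples N. cmod (c t))"
    unfolding c(1) by (intro F.cnorm_finsum_le finite_triples Pi_I F.word_val_in
        F.cnorm_word_val_le_1 std_word_nonempty)
  with sum show "cnorm mat_seq_algebra x \<le> 4 * (real N + 1) ^ 3 * K"
    by (rule order.trans[rotated])
  have "cnorm B y \<le> (\<Sum>t\<in>triples N. cmod (c t))"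
    unfolding c(2) by (intro B.cnorm_finsum_le finite_triples Pi_I B.word_val_in
        B.cnorm_word_val_le_1 std_word_nonempty)
  with sum show "cnorm B y \<le> 4 * (real N + 1) ^ 3 * K"
    by (rule order.trans[rotated])
qed

text \<open>
  Entries of the truncated shifts are bounded by the norm, and the polynomial factor of
  \<open>same_poly_bound\<close> disappears by \<open>same_poly_contractive\<close>.
\<close>

theorem cnorm_le_shift:
  assumes "sp n x y"
  shows "cnorm B y \<le> cnorm mat_seq_algebra x"
proof (rule same_poly_contractive[OF _ assms])
  fix n x y assume xy: "sp n x y"
  show "cnorm B y \<le> 4 * (real n + 1) ^ 3 * cnorm mat_seq_algebra x"
    by (rule same_poly_bound(2)[OF xy cmod_entry_le_cnorm]) (use same_poly_in[OF xy] in auto)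
qed

end

section \<open>The universal property and uniqueness\<close>

lemma word_val_carrier_update [simp]: "word_val (A\<lparr>carrier := C\<rparr>) v u = word_val A v u"
  by (induction A v u rule: word_val.induct) (simp_all add: letter_def)

lemma same_poly_carrier_update [simp]:
  "same_poly (A\<lparr>carrier := C\<rparr>) v B w n x y \<longleftrightarrow> same_poly A v B w n x y"
proof
  show "same_poly (A\<lparr>carrier := C\<rparr>) v B w n x y \<Longrightarrow> same_poly A v B w n x y"
  proof (induction rule: same_poly.induct)
    case (step x y u c)
    then show ?case using same_poly.step[of A v B w n x y u c] by simp
  qed (simp add: same_poly.zero)
  show "same_poly A v B w n x y \<Longrightarrow> same_poly (A\<lparr>carrier := C\<rparr>) v B w n x y"
  proof (induction rule: same_poly.induct)
    case zero
    show ?case using same_poly.zero[of "A\<lparr>carrier := C\<rparr>"] by simp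
  next
    case (step x y u c)
    then show ?case using same_poly.step[of "A\<lparr>carrier := C\<rparr>" v B w n x y u c] by simp
  qed
qed

text \<open>
  C*-subalgebras of the generated subalgebra are C*-subalgebras of the ambient algebra, so it
  has no proper C*-subalgebra containing the generator.
\<close>

lemma generated_by_ppi_generated:
  assumes "cstar_algebra A" "power_partial_isometry A v"
  shows "generated_by_ppi (A\<lparr>carrier := cstar_generated A v\<rparr>) v"
proof -
  interpret ppi A v using assms by (intro ppi.intro ppi_axioms.intro)
  let ?C = "cstar_generated A v"
  let ?G = "A\<lparr>carrier := ?C\<rparr>"
  note sub = cstar_subalgebra_generated[OF assms(1) element_in]
  note closed = cstar_subalgebraD[OF assms(1) sub(1)]
  have pow: "pow_Suc ?G v n = pow_Suc A v n \<and> pow_Suc A v n \<in> ?C" for n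
    by (induction n) (simp_all add: sub(2) closed(5))
  have "power_partial_isometry ?G v"
    using assms(2) pow by (simp add: power_partial_isometry_def partial_isometry_def)
  moreover have "cstar_generated ?G v = ?C"
  proof
    have "cstar_subalgebra ?C ?G"
      using sub(1) by (simp add: cstar_subalgebra_def)
    then show "cstar_generated ?G v \<subseteq> ?C"
      using sub(2) unfolding cstar_generated_def by blast
    have "cstar_subalgebra D A" if "cstar_subalgebra D ?G" for D
      using that closed(1) by (auto simp: cstar_subalgebra_def)
    then show "?C \<subseteq> cstar_generated ?G v"
      unfolding cstar_generated_def by blast
  qed
  ultimately show ?thesis
    using sub(1) by (simp add: generated_by_ppi_def cstar_subalgebra_def)
qed

lemma generated_by_ppi_shift_sections: "generated_by_ppi shift_sections_algebra shift_sections"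
  unfolding shift_sections_algebra_def
  by (rule generated_by_ppi_generated[OF cstar_algebra_mat_seq power_partial_isometry_shift_sections])

lemma generated_by_ppiD:
  assumes "generated_by_ppi A v"
  shows "ppi A v" "cstar_generated A v = carrier A" "cstar_element A v"
proof -
  show ppi: "ppi A v" "cstar_generated A v = carrier A"
    using assms by (simp_all add: generated_by_ppi_def ppi_def ppi_axioms_def)
  interpret ppi A v by (rule ppi)
  show "cstar_element A v" ..
qed

lemma cnorm_shift_sections_algebra: "cnorm shift_sections_algebra = cnorm mat_seq_algebra"
  by (simp add: shift_sections_algebra_def)

lemma same_poly_shift_sections_algebra:
  "same_poly shift_sections_algebra v B w n x y \<longleftrightarrow> same_poly mat_seq_algebra v B w n x y"
  by (simp add: shift_sections_algebra_def)

lemma contractive_shift_sections: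
  assumes "generated_by_ppi B w"
  shows "contractive_pair shift_sections_algebra shift_sections B w"
proof -
  interpret shift_ppi_pair B w
    using generated_by_ppiD(1)[OF assms] by (rule shift_ppi_pair.intro)
  interpret S: cstar_element shift_sections_algebra shift_sections
    by (rule generated_by_ppiD(3)[OF generated_by_ppi_shift_sections])
  show ?thesis
    by unfold_locales (simp add: same_poly_shift_sections_algebra cnorm_shift_sections_algebra cnorm_le_shift)
qed

text \<open>
  The polynomial \<open>v\<^sup>m - v\<^sup>* v\<^sup>m\<^sup>+\<^sup>1 - v\<^sup>m\<^sup>+\<^sup>1 v\<^sup>* + v\<^sup>* v\<^sup>m\<^sup>+\<^sup>2 v\<^sup>*\<close>, formally \<open>(1 - v\<^sup>* v) v\<^sup>m (1 - v v\<^sup>*)\<close>. For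
  a truncated shift, the outer factors project to the last and to the first basis vector, and
  \<open>v\<^sup>m\<close> maps the first basis vector to the last one exactly in dimension \<open>m + 1\<close>.
\<close>

definition corner :: "'a cstar \<Rightarrow> 'a \<Rightarrow> nat \<Rightarrow> 'a" where
  "corner A v m =
    (word_val A v (replicate m True) \<ominus>\<^bsub>A\<^esub> word_val A v (False # replicate (Suc m) True)) \<ominus>\<^bsub>A\<^esub>
    (word_val A v (replicate (Suc m) True @ [False]) \<ominus>\<^bsub>A\<^esub>
      word_val A v (False # replicate (Suc (Suc m)) True @ [False]))"

lemma (in cstar_element) corner_in [simp, intro]: "corner A v m \<in> carrier A"
  by (simp add: corner_def)

lemma (in ppi) cnorm_corner_le:
  assumes "1 \<le> m"
  shows "cnorm A (corner A v m) \<le> 4"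
proof -
  have "cnorm A (corner A v m) \<le> (1 + 1) + (1 + 1)"
    unfolding corner_def using assms
    by (intro order.trans[OF cnorm_minus_le] add_mono cnorm_word_val_le_1 minus_in word_val_in) auto
  then show ?thesis by simp
qed

lemma (in cstar_element_pair) same_poly_corner:
  assumes "1 \<le> m"
  shows "sp (m + 4) (corner A v m) (corner B w m)"
  unfolding corner_def using assms by (intro same_poly_minus same_poly_word) auto

lemma mat_seq_minus_index:
  assumes "X \<in> carrier mat_seq_algebra" "Y \<in> carrier mat_seq_algebra" "i < n" "j < n"
  shows "(X \<ominus>\<^bsub>mat_seq_algebra\<^esub> Y) n $$ (i, j) = X n $$ (i, j) - Y n $$ (i, j)"
  using F.minus_eq_smult[OF assms(1,2)] carrier_matD[OF mat_seq_carrier_mat[OF assms(1), of n]]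
    carrier_matD[OF mat_seq_carrier_mat[OF assms(2), of n]] assms(3,4) by simp

lemma mat_seq_mult_index:
  assumes "X \<in> carrier mat_seq_algebra" "Y \<in> carrier mat_seq_algebra" "i < n" "j < n"
  shows "(X \<otimes>\<^bsub>mat_seq_algebra\<^esub> Y) n $$ (i, j) = (\<Sum>r<n. X n $$ (i, r) * Y n $$ (r, j))"
  using carrier_matD[OF mat_seq_carrier_mat[OF assms(1), of n]]
    carrier_matD[OF mat_seq_carrier_mat[OF assms(2), of n]] assms(3,4)
  by (simp add: scalar_prod_def atLeast0LessThan)

lemma corner_shift_index:
  assumes "1 \<le> m" "i < n" "j < n"
  shows "corner mat_seq_algebra shift_sections m n $$ (i, j) = of_bool (n = Suc m \<and> i = m \<and> j = 0)"
proof -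
  let ?w = "\<lambda>u. word_val mat_seq_algebra shift_sections u n $$ (i, j)"
  have one: "seq_one n $$ (p, j) = of_bool (p = j)" if "p < n" for p
    using that assms(3) by (simp add: seq_one_def)
  have T: "word_act mat_seq_algebra shift_sections (replicate k True) X n $$ (p, j) =
      (if k \<le> p then X n $$ (p - k, j) else 0)"
    if "X \<in> carrier mat_seq_algebra" "p < n" for X k p
    using word_act_shift_True[OF that assms(3)] .
  have Fa: "word_act mat_seq_algebra shift_sections [False] X n $$ (p, j) =
      (if p + 1 < n then X n $$ (p + 1, j) else 0)"
    if "X \<in> carrier mat_seq_algebra" "p < n" for X p
    using word_act_shift_False[OF that assms(3), of 1] by simp
  have 1: "?w (replicate m True) = of_bool (i = j + m)"
    using assms by (auto simp: word_val_shift T one)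
  have "?w ([False] @ replicate (Suc m) True) = of_bool (i = j + m \<and> i + 1 < n)"
    using assms
    by (subst word_val_shift, simp, subst word_act_append, subst Fa) (auto simp: T one simp del: replicate_Suc)
  then have 2: "?w (False # replicate (Suc m) True) = of_bool (i = j + m \<and> i + 1 < n)"
    by simp
  have 3: "?w (replicate (Suc m) True @ [False]) = of_bool (i = j + m \<and> 1 \<le> j)"
    using assms
    by (subst word_val_shift, simp, subst word_act_append, subst T) (auto simp: Fa one simp del: replicate_Suc word_act_Cons)
  have "?w ([False] @ replicate (Suc (Suc m)) True @ [False]) = of_bool (i = j + m \<and> 1 \<le> j \<and> i + 1 < n)"
    using assms
    by (subst word_val_shift, simp, subst word_act_append, subst Fa)
      (auto simp: Fa T one simp del: replicate_Suc word_act_Cons)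
  then have 4: "?w (False # replicate (Suc (Suc m)) True @ [False]) = of_bool (i = j + m \<and> 1 \<le> j \<and> i + 1 < n)"
    by simp
  show ?thesis
    unfolding corner_def using assms(2,3)
    by (simp only: mat_seq_minus_index F.minus_in F.word_val_in 1 2 3 4) auto
qed

text \<open>
  In block \<open>m + 1\<close> the corner \<open>q\<close> is the matrix unit with row \<open>m\<close> and column \<open>0\<close>. Moving its
  row \<open>m\<close> to row \<open>j\<close> makes \<open>x\<close> select its column \<open>j\<close>, and row \<open>i\<close> of the result is moved to row
  \<open>0\<close> where \<open>q\<close> picks it up.
\<close>

lemma corner_sandwich:
  assumes x: "x \<in> carrier mat_seq_algebra" and "1 \<le> m" "i \<le> m" "j \<le> m"
  defines "q \<equiv> corner mat_seq_algebra shift_sections m"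
    and "L \<equiv> word_act mat_seq_algebra shift_sections"
  shows "q \<otimes>\<^bsub>mat_seq_algebra\<^esub> L (replicate i False)
      (x \<otimes>\<^bsub>mat_seq_algebra\<^esub> L (replicate j True @ replicate m False) q) =
    x (Suc m) $$ (i, j) \<odot>\<^bsub>mat_seq_algebra\<^esub> q"
proof -
  let ?N = "Suc m"
  have q: "q \<in> carrier mat_seq_algebra"
    by (simp only: q_def F.corner_in)
  have q_index: "q n $$ (p, s) = of_bool (n = ?N \<and> p = m \<and> s = 0)" if "p < n" "s < n" for n p s
    using corner_shift_index[OF \<open>1 \<le> m\<close> that] by (simp add: q_def)
  define y where "y = L (replicate j True @ replicate m False) q"
  have y: "y \<in> carrier mat_seq_algebra"
    using q by (simp only: y_def L_def F.word_act_in)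
  have y_index: "y n $$ (p, s) = of_bool (n = ?N \<and> p = j \<and> s = 0)" if "p < n" "s < n" for n p s
    using that q \<open>j \<le> m\<close>
    by (auto simp: y_def L_def word_act_shift_True[OF F.word_act_in] word_act_shift_False q_index)
  define z where "z = x \<otimes>\<^bsub>mat_seq_algebra\<^esub> y"
  have z: "z \<in> carrier mat_seq_algebra"
    using x y by (simp only: z_def F.mult_closed)
  have z_index: "z n $$ (p, s) = (if n = ?N \<and> s = 0 then x ?N $$ (p, j) else 0)"
    if "p < n" "s < n" for n p s
  proof -
    have "z n $$ (p, s) = (\<Sum>r<n. x n $$ (p, r) * of_bool (n = ?N \<and> r = j \<and> s = 0))"
      unfolding z_def mat_seq_mult_index[OF x y that] using that
      by (intro sum.cong) (simp_all add: y_index)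
    also have "\<dots> = (\<Sum>r<n. if r = j then (if n = ?N \<and> s = 0 then x ?N $$ (p, j) else 0) else 0)"
      by (intro sum.cong) auto
    finally show ?thesis
      using \<open>j \<le> m\<close> by auto
  qed
  define u where "u = L (replicate i False) z"
  have u: "u \<in> carrier mat_seq_algebra"
    using z by (simp only: u_def L_def F.word_act_in)
  have u_index: "u n $$ (p, s) = (if p + i < n then z n $$ (p + i, s) else 0)" if "p < n" "s < n" for n p s
    using word_act_shift_False[OF z that] by (simp add: u_def L_def)
  have "q \<otimes>\<^bsub>mat_seq_algebra\<^esub> u = x ?N $$ (i, j) \<odot>\<^bsub>mat_seq_algebra\<^esub> q"
  proof (rule mat_seq_eqI)
    fix n p s :: nat assume ps: "p < n" "s < n"
    have "(q \<otimes>\<^bsub>mat_seq_algebra\<^esub> u) n $$ (p, s) = (\<Sum>r<n. of_bool (n = ?N \<and> p = m \<and> r = 0) * u n $$ (r, s))"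
      unfolding mat_seq_mult_index[OF q u ps] using ps by (intro sum.cong) (simp_all add: q_index)
    also have "\<dots> = (\<Sum>r<n. if r = 0 then of_bool (n = ?N \<and> p = m) * u n $$ (0, s) else 0)"
      by (intro sum.cong) auto
    also have "\<dots> = of_bool (n = ?N \<and> p = m) * u n $$ (0, s)"
      using ps by simp
    also have "\<dots> = x ?N $$ (i, j) * q n $$ (p, s)"
      using ps \<open>i \<le> m\<close> by (auto simp: u_index z_index q_index)
    also have "\<dots> = (x ?N $$ (i, j) \<odot>\<^bsub>mat_seq_algebra\<^esub> q) n $$ (p, s)"
      using ps carrier_matD[OF mat_seq_carrier_mat[OF q, of n]] by simp
    finally show "(q \<otimes>\<^bsub>mat_seq_algebra\<^esub> u) n $$ (p, s) = (x ?N $$ (i, j) \<odot>\<^bsub>mat_seq_algebra\<^esub> q) n $$ (p, s)" .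
  qed (intro F.mult_closed F.smult_in q u)+
  then show ?thesis
    by (simp only: u_def z_def y_def)
qed

context shift_ppi_pair
begin

text \<open>
  The identity of \<open>corner_sandwich\<close> transfers to \<open>B\<close> because \<open>p(V) \<mapsto> p(w)\<close> is a function. Taking
  norms there bounds the entry, as the corner is nonzero in \<open>B\<close> and has norm at most four.
\<close>

lemma cmod_entry_le:
  assumes xy: "sp n x y" and nonzero: "\<And>m. 1 \<le> m \<Longrightarrow> corner B w m \<noteq> \<zero>\<^bsub>B\<^esub>"
    and ij: "i < N" "j < N"
  shows "cmod (x N $$ (i, j)) \<le> 4 * cnorm B y"
proof (cases "N \<le> 1")
  case True
  then have N: "N = 1" "i = 0" "j = 0" using ij by auto
  \<comment> \<open>In the block of size one all normal forms vanish, since \<open>a = b = 0\<close> is excluded.\<close>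
  obtain c where "\<And>N i j. \<lbrakk>i < N; j < N\<rbrakk> \<Longrightarrow> x N $$ (i, j) = (\<Sum>t\<in>triples n. c t * std_entry N i j t)"
    using same_poly_coefficients[OF xy] by blast
  from this[of 0 1 0] have "x N $$ (i, j) = 0"
    using N by (auto simp: triples_def intro!: sum.neutral)
  then show ?thesis
    using B.cnorm_nonneg same_poly_in[OF xy] by simp
next
  case False
  define m where "m = N - 1"
  have m: "N = Suc m" "1 \<le> m" "i \<le> m" "j \<le> m"
    using False ij by (auto simp: m_def)
  interpret contractive_pair mat_seq_algebra shift_sections B w
    by unfold_locales (rule cnorm_le_shift)
  let ?F = mat_seq_algebra
  let ?q = "corner ?F shift_sections m" and ?r = "corner B w m"
  let ?y' = "word_act B w (replicate i False) (y \<otimes>\<^bsub>B\<^esub> word_act B w (replicate j True @ replicate m False) ?r)"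
  let ?l = "x N $$ (i, j)"
  note in_carrier = same_poly_in[OF xy]
  note qr = same_poly_corner[OF m(2)]
  have "\<exists>k. sp k (?q \<otimes>\<^bsub>?F\<^esub> word_act ?F shift_sections (replicate i False)
      (x \<otimes>\<^bsub>?F\<^esub> word_act ?F shift_sections (replicate j True @ replicate m False) ?q)) (?r \<otimes>\<^bsub>B\<^esub> ?y')"
    by (rule exI) (rule same_poly_mult[OF qr same_poly_word_act[OF same_poly_mult[OF xy same_poly_word_act[OF qr]]]])
  then obtain k where k: "sp k (?l \<odot>\<^bsub>?F\<^esub> ?q) (?r \<otimes>\<^bsub>B\<^esub> ?y')"
    using corner_sandwich[OF conjunct1[OF in_carrier] m(2-4)] m(1) by metis
  have eq: "?r \<otimes>\<^bsub>B\<^esub> ?y' = ?l \<odot>\<^bsub>B\<^esub> ?r"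
    by (rule same_limit_unique[OF same_limit_poly[OF k] same_limit_poly[OF same_poly_smult[OF qr]]])
  have pos: "0 < cnorm B ?r"
    using nonzero[OF m(2)] B.cnorm_eq_0[of ?r] B.cnorm_nonneg[of ?r] by (simp add: order_less_le)
  have "cmod ?l * cnorm B ?r = cnorm B (?r \<otimes>\<^bsub>B\<^esub> ?y')"
    unfolding eq by (simp add: B.cnorm_smult)
  also have "\<dots> \<le> cnorm B ?r * cnorm B ?y'"
    using in_carrier by (intro B.cnorm_mult) auto
  also have "cnorm B ?y' \<le> cnorm B (y \<otimes>\<^bsub>B\<^esub> word_act B w (replicate j True @ replicate m False) ?r)"
    using in_carrier by (intro B.cnorm_word_act_le) auto
  also have "\<dots> \<le> cnorm B y * cnorm B (word_act B w (replicate j True @ replicate m False) ?r)"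
    using in_carrier by (intro B.cnorm_mult) auto
  also have "\<dots> \<le> cnorm B y * cnorm B ?r"
    using in_carrier B.cnorm_nonneg by (intro mult_left_mono B.cnorm_word_act_le) auto
  also have "\<dots> \<le> cnorm B y * 4"
    using in_carrier B.cnorm_nonneg B.cnorm_corner_le[OF m(2)] by (intro mult_left_mono) auto
  finally show ?thesis
    using pos by (simp add: mult.commute)
qed

text \<open>
  The entries of \<open>p(V)\<close> are now bounded by the norm of \<open>p(w)\<close>, so the growth argument applies in
  the opposite direction.
\<close>

lemma shift_cnorm_le:
  assumes "\<And>m. 1 \<le> m \<Longrightarrow> corner B w m \<noteq> \<zero>\<^bsub>B\<^esub>" and "sp n x y"
  shows "cnorm mat_seq_algebra x \<le> cnorm B y"
proof -
  interpret BF: ppi_pair B w mat_seq_algebra shift_sections ..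
  show ?thesis
  proof (rule BF.same_poly_contractive[OF _ same_poly_sym[OF assms(2)]])
    fix n y x assume "same_poly B w mat_seq_algebra shift_sections n y x"
    then have "sp n x y" by (rule same_poly_sym)
    then have "cnorm mat_seq_algebra x \<le> 4 * (real n + 1) ^ 3 * (4 * cnorm B y)"
      by (rule same_poly_bound(1)) (rule cmod_entry_le[OF \<open>sp n x y\<close> assms(1)])
    then show "cnorm mat_seq_algebra x \<le> 16 * (real n + 1) ^ 3 * cnorm B y"
      by simp
  qed
qed

end

text \<open>
  The given *-homomorphism sends the corners of \<open>v\<close> to those of the truncated shifts, which are
  nonzero. Hence the corners of \<open>v\<close> are nonzero, as \<open>shift_cnorm_le\<close> requires.
\<close>

lemma contractive_universal:
  assumes "generated_by_ppi A v" "h \<in> star_hom A shift_sections_algebra" "h v = shift_sections"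
  shows "contractive_pair A v shift_sections_algebra shift_sections"
proof -
  let ?S = shift_sections_algebra
  interpret shift_ppi_pair A v
    using generated_by_ppiD(1)[OF assms(1)] by (rule shift_ppi_pair.intro)
  interpret S: cstar_element ?S shift_sections
    by (rule generated_by_ppiD(3)[OF generated_by_ppi_shift_sections])
  have nonzero: "corner A v m \<noteq> \<zero>\<^bsub>A\<^esub>" if m: "1 \<le> m" for m
  proof
    assume "corner A v m = \<zero>\<^bsub>A\<^esub>"
    moreover have "same_poly ?S shift_sections A v (m + 4) (corner mat_seq_algebra shift_sections m) (corner A v m)"
      using same_poly_corner[OF m] by (simp only: same_poly_shift_sections_algebra)
    ultimately have h0: "h \<zero>\<^bsub>A\<^esub> = corner mat_seq_algebra shift_sections m"
      using same_poly_star_hom[OF B.cstar_algebra_axioms B.element_in S.cstar_algebra_axioms assms(2,3)]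
        same_poly_sym by metis
    have "h \<zero>\<^bsub>A\<^esub> = \<zero>\<^bsub>mat_seq_algebra\<^esub>"
      using same_poly_star_hom[OF B.cstar_algebra_axioms B.element_in S.cstar_algebra_axioms assms(2,3) same_poly.zero]
      by (simp add: shift_sections_algebra_def)
    then have "corner mat_seq_algebra shift_sections m (Suc m) $$ (m, 0) = 0"
      unfolding h0[symmetric] by simp
    then show False
      using corner_shift_index[OF m, of m "Suc m" 0] by simp
  qed
  show ?thesis
  proof unfold_locales
    fix n x y assume "same_poly A v ?S shift_sections n x y"
    then have "sp n y x"
      using same_poly_sym[of A v ?S] by (simp add: same_poly_shift_sections_algebra)
    then show "cnorm ?S y \<le> cnorm A x"
      unfolding cnorm_shift_sections_algebra using nonzero by (intro shift_cnorm_le)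
  qed
qed

theorem theorem1:
  shows "universal_ppi_algebra TYPE('b) shift_sections_algebra shift_sections \<and>
    (\<forall>(A::'a cstar) v. universal_ppi_algebra TYPE(nat \<Rightarrow> complex mat) A v \<longrightarrow>
       star_isomorphic A shift_sections_algebra)"
proof (intro conjI allI impI)
  note S = generated_by_ppi_shift_sections
  show "universal_ppi_algebra TYPE('b) shift_sections_algebra shift_sections"
    unfolding universal_ppi_algebra_def
  proof (intro conjI allI impI S)
    fix B :: "'b cstar" and w assume "generated_by_ppi B w"
    from contractive_pair.star_hom_exists[OF contractive_shift_sections[OF this] generated_by_ppiD(2)[OF S]]
    show "\<exists>h\<in>star_hom shift_sections_algebra B. h shift_sections = w"
      by blast
  qed
  fix A :: "'a cstar" and v assume "universal_ppi_algebra TYPE(nat \<Rightarrow> complex mat) A v"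
  then have A: "generated_by_ppi A v"
    and "\<exists>h\<in>star_hom A shift_sections_algebra. h v = shift_sections"
    using S by (auto simp: universal_ppi_algebra_def)
  then obtain h where h: "h \<in> star_hom A shift_sections_algebra" "h v = shift_sections"
    by blast
  show "star_isomorphic A shift_sections_algebra"
    by (rule isometric_star_isomorphic[OF contractive_universal[OF A h] contractive_shift_sections[OF A]
          generated_by_ppiD(2)[OF A] generated_by_ppiD(2)[OF S]])
qed

end
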